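(* Let $q=4$. Under $G_4$ there are exactly $12$ line orbits, namely: the sets of RC-lines ($10$), RA-lines ($10$), Un$\Gamma$-lines ($60$) and E$\Gamma$-lines ($60$); the $G_4^*$-orbit of U$\Gamma$-lines of size $15$; the union of the Tr-lines with the $G_4^*$-orbit of U$\Gamma$-lines of size $5$ (total $10$); the union of the IC-lines and the IA-lines (total $12$); and, for the En$\Gamma$-lines: exactly one of the three $G_4^*$-orbits of size $20$ is a $G_4$-orbit, while the other two merge into one $G_4$-orbit of size $40$; exactly two of the four $G_4^*$-orbits of size $30$ are $G_4$-orbits, while the other two merge into one $G_4$-orbit of size $60$. In particular, with $\xi$ a primitive element of $\mathbb F_4$, the lines $\{x_2=0,\ x_0=\xi x_3\}$ and $\{x_1=0,\ x_0=\xi x_3\}$ are En$\Gamma$-lines lying in the two distinct $G_4^*$-orbits of size $20$ that merge.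
   Context: Notation. $\mathbb F_q$ is the field with $q$ elements, $\mathbb F_q^+=\mathbb F_q\cup\{\infty\}$. Points of $\mathrm{PG}(3,q)$ are written $\mathbf P(x_0,x_1,x_2,x_3)$ with $x$ a nonzero row vector up to scalars; $\boldsymbol\pi(c_0,c_1,c_2,c_3)$ is the plane $c_0x_0+c_1x_1+c_2x_2+c_3x_3=0$. Put $P(t)=\mathbf P(t^3,t^2,t,1)$ for $t\in\mathbb F_q$, $P(\infty)=\mathbf P(1,0,0,0)$, and $\mathscr C=\{P(t):t\in\mathbb F_q^+\}$ (the twisted cubic). The osculating planes are $\pi_{\rm osc}(t)=\boldsymbol\pi(1,-3t,3t^2,-t^3)$ ($t\in\mathbb F_q$) and $\pi_{\rm osc}(\infty)=\boldsymbol\pi(0,0,0,1)$; these $q+1$ planes are called $\Gamma$-planes. The tangent at $P(t)$, $t\in\mathbb F_q$, is the line through $P(t)$ and $\mathbf P(3t^2,2t,1,0)$; the tangent at $P(\infty)$ is the line through $\mathbf P(1,0,0,0)$ and $\mathbf P(0,1,0,0)$. A real chord is a line through two distinct points of $\mathscr C$; a real axis is the intersection of two distinct $\Gamma$-planes. For $\alpha\in\mathbb F_{q^2}\setminus\mathbb F_q$, the line of $\mathrm{PG}(3,q^2)$ through $P(\alpha),P(\alpha^q)$ (resp. the intersection of the planes $\pi_{\rm osc}(\alpha),\pi_{\rm osc}(\alpha^q)$, given by the same formulas over $\mathbb F_{q^2}$) is defined over $\mathbb F_q$, and the corresponding line of $\mathrm{PG}(3,q)$ is an imaginary chord (resp.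 imaginary axis). A unisecant is a line meeting $\mathscr C$ in exactly one point; an external line is a line disjoint from $\mathscr C$. $G_q$ is the group of all projectivities of $\mathrm{PG}(3,q)$ mapping $\mathscr C$ onto itself. For $a,b,c,d\in\mathbb F_q$, $ad-bc\ne0$, let $$M(a,b,c,d)=\begin{pmatrix} a^3&a^2c&ac^2&c^3\\ 3a^2b&a^2d+2abc&bc^2+2acd&3c^2d\\ 3ab^2&b^2c+2abd&ad^2+2bcd&3cd^2\\ b^3&b^2d&bd^2&d^3\end{pmatrix};$$ the projectivities $\mathbf P(x)\mapsto\mathbf P(xM(a,b,c,d))$ form the subgroup $G_q^*\cong PGL(2,q)$ of $G_q$ (critical subgroup). Line types (for $q\not\equiv0\pmod 3$): RC = real chord; Tr = tangent; IC = imaginary chord; RA = real axis; IA = imaginary axis; U$\Gamma$ = unisecant which is not a tangent and is contained in some $\Gamma$-plane; Un$\Gamma$ = unisecant contained in no $\Gamma$-plane; E$\Gamma$ = external line contained in exactly one $\Gamma$-plane; En$\Gamma$ = external line contained in no $\Gamma$-plane that is neither an imaginary chord nor an imaginary axis. Known fact for $q=4$: under $G_4^*$ the U$\Gamma$-lines form two orbits, of sizes $5$ and $15$, and the En$\Gamma$-lines form seven orbits, three of size $20$ and four of size $30$; each other line type forms a single $G_4^*$-orbit. *)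

theory Defs
  imports Main
begin

datatype gf4 = G0 | G1 | Ga | Gb

instantiation gf4 :: field
begin
fun plus_gf4 :: "gf4 \<Rightarrow> gf4 \<Rightarrow> gf4" where
  "plus_gf4 G0 y = y"
| "plus_gf4 x G0 = x"
| "plus_gf4 G1 G1 = G0" | "plus_gf4 G1 Ga = Gb" | "plus_gf4 G1 Gb = Ga"
| "plus_gf4 Ga G1 = Gb" | "plus_gf4 Ga Ga = G0" | "plus_gf4 Ga Gb = G1"
| "plus_gf4 Gb G1 = Ga" | "plus_gf4 Gb Ga = G1" | "plus_gf4 Gb Gb = G0"
fun times_gf4 :: "gf4 \<Rightarrow> gf4 \<Rightarrow> gf4" where
  "times_gf4 G0 y = G0"
| "times_gf4 x G0 = G0"
| "times_gf4 G1 y = y"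
| "times_gf4 x G1 = x"
| "times_gf4 Ga Ga = Gb" | "times_gf4 Ga Gb = G1"
| "times_gf4 Gb Ga = G1" | "times_gf4 Gb Gb = Ga"
fun inverse_gf4 :: "gf4 \<Rightarrow> gf4" where
  "inverse_gf4 G0 = G0" | "inverse_gf4 G1 = G1"
| "inverse_gf4 Ga = Gb" | "inverse_gf4 Gb = Ga"
definition zero_gf4 :: gf4 where "zero_gf4 = G0"
definition one_gf4 :: gf4 where "one_gf4 = G1"
definition uminus_gf4 :: "gf4 \<Rightarrow> gf4" where "uminus_gf4 x = x"
definition minus_gf4 :: "gf4 \<Rightarrow> gf4 \<Rightarrow> gf4" where "minus_gf4 x y = x + y"
definition "x div y = x * inverse y" for x y :: gf4
instance
proof
  fix a b c :: gf4
  show "a + b + c = a + (b + c)" by (cases a; cases b; cases c) simp_all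
  show "a + b = b + a" by (cases a; cases b) simp_all
  show "0 + a = a" by (simp add: zero_gf4_def)
  show "- a + a = 0" by (cases a) (simp_all add: zero_gf4_def uminus_gf4_def)
  show "a - b = a + - b" by (simp add: minus_gf4_def uminus_gf4_def)
  show "a * b * c = a * (b * c)" by (cases a; cases b; cases c) simp_all
  show "a * b = b * a" by (cases a; cases b) simp_all
  show "1 * a = a" by (cases a) (simp_all add: one_gf4_def)
  show "(a + b) * c = a * c + b * c" by (cases a; cases b; cases c) simp_all
  show "(0::gf4) \<noteq> 1" by (simp add: zero_gf4_def one_gf4_def)
  show "a \<noteq> 0 \<Longrightarrow> inverse a * a = 1" by (cases a) (simp_all add: zero_gf4_def one_gf4_def)
  show "divide a b = a * inverse b" by (simp add: divide_gf4_def)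
  show "inverse (0::gf4) = 0" by (simp add: zero_gf4_def)
qed
end

instantiation gf4 :: finite begin
lemma UNIV_gf4: "(UNIV::gf4 set) = {G0,G1,Ga,Gb}" by (auto intro: gf4.exhaust)
instance by standard (simp add: UNIV_gf4)
end

lemma add_self: "(x::gf4) + x = 0" by (cases x) (simp_all add: zero_gf4_def)

datatype gf16 = F16 gf4 gf4

instantiation gf16 :: field
begin
fun plus_gf16 where "plus_gf16 (F16 a b) (F16 c d) = F16 (a + c) (b + d)"
fun times_gf16 where "times_gf16 (F16 a b) (F16 c d) = F16 (a*c + b*d*Ga) (a*d + b*c + b*d)"
fun inverse_gf16 where "inverse_gf16 (F16 a b) = (let n = a*a + a*b + b*b*Ga in F16 ((a+b) * inverse n) (b * inverse n))"
definition zero_gf16 where "zero_gf16 = F16 0 0"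
definition one_gf16 where "one_gf16 = F16 1 0"
definition uminus_gf16 :: "gf16 \<Rightarrow> gf16" where "uminus_gf16 x = x"
definition minus_gf16 :: "gf16 \<Rightarrow> gf16 \<Rightarrow> gf16" where "minus_gf16 x y = x + y"
definition "x div y = x * inverse y" for x y :: gf16
lemma ex16: "(\<And>a b. P (F16 a b)) \<Longrightarrow> P x" by (cases x) auto
lemma all4: "(\<forall>x::gf4. P x) = (P G0 \<and> P G1 \<and> P Ga \<and> P Gb)" by (metis gf4.exhaust)
instance
proof
  fix a b c :: gf16
  show "a + b + c = a + (b + c)" by (cases a; cases b; cases c) (simp add: add.assoc)
  show "a + b = b + a" by (cases a; cases b) (simp add: add.commute)
  show "0 + a = a" by (cases a) (simp add: zero_gf16_def)
  show "- a + a = 0" by (cases a) (simp add: zero_gf16_def uminus_gf16_def add_self)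
  show "a - b = a + - b" by (simp add: minus_gf16_def uminus_gf16_def)
  show "a * b * c = a * (b * c)"
    by (cases a; cases b; cases c) (simp add: algebra_simps)
  show "a * b = b * a" by (cases a; cases b) (simp add: algebra_simps)
  show "1 * a = a" by (cases a) (simp add: one_gf16_def)
  show "(a + b) * c = a * c + b * c" by (cases a; cases b; cases c) (simp add: algebra_simps)
  show "(0::gf16) \<noteq> 1" by (simp add: zero_gf16_def one_gf16_def)
  show "a \<noteq> 0 \<Longrightarrow> inverse a * a = 1"
    apply (cases a)
    subgoal for a1 a2 by (cases a1; cases a2) (simp_all add: zero_gf16_def one_gf16_def zero_gf4_def one_gf4_def Let_def)
    done
  show "divide a b = a * inverse b" by (simp add: divide_gf16_def)
  show "inverse (0::gf16) = 0" by (simp add: zero_gf16_def zero_gf4_def)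
qed
end

text \<open>gf16 = F_4[theta]/(theta^2+theta+Ga), a model of F_16 = F_(q^2); F_4 sits inside via emb.\<close>
definition emb :: "gf4 \<Rightarrow> gf16" where "emb a = F16 a 0"

definition primitive_elem :: "gf4 \<Rightarrow> bool" where
  "primitive_elem \<xi> \<longleftrightarrow> (\<forall>y::gf4. y \<noteq> 0 \<longrightarrow> (\<exists>k::nat. y = \<xi> ^ k))"

datatype idx = X0 | X1 | X2 | X3

lemma UNIV_idx: "(UNIV::idx set) = {X0,X1,X2,X3}" by (auto intro: idx.exhaust)
instantiation idx :: finite begin
instance by standard (simp add: UNIV_idx)
end

type_synonym 'a vec = "idx \<Rightarrow> 'a"

definition vec4 :: "'a \<Rightarrow> 'a \<Rightarrow> 'a \<Rightarrow> 'a \<Rightarrow> 'a vec" where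
  "vec4 a b c d = (\<lambda>i. case i of X0 \<Rightarrow> a | X1 \<Rightarrow> b | X2 \<Rightarrow> c | X3 \<Rightarrow> d)"

definition zvec :: "'a::zero vec" where "zvec = (\<lambda>i. 0)"
definition smul :: "'a::times \<Rightarrow> 'a vec \<Rightarrow> 'a vec" where "smul c v = (\<lambda>i. c * v i)"
definition vadd :: "'a::plus vec \<Rightarrow> 'a vec \<Rightarrow> 'a vec" where "vadd u v = (\<lambda>i. u i + v i)"
definition dot :: "'a::comm_ring_1 vec \<Rightarrow> 'a vec \<Rightarrow> 'a" where "dot c x = (\<Sum>i\<in>UNIV. c i * x i)"

definition pt :: "'a::field vec \<Rightarrow> 'a vec set" where
  "pt v = {smul c v | c. c \<noteq> 0}"

definition line_through :: "'a::field vec \<Rightarrow> 'a vec \<Rightarrow> 'a vec set set" where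
  "line_through u v = {pt (vadd (smul a u) (smul b v)) | a b. vadd (smul a u) (smul b v) \<noteq> zvec}"

definition lines :: "'a::field vec set set set" where
  "lines = {line_through u v | u v. u \<noteq> zvec \<and> v \<noteq> zvec \<and> pt u \<noteq> pt v}"

definition plane :: "'a::field vec \<Rightarrow> 'a vec set set" where
  "plane c = {pt x | x. x \<noteq> zvec \<and> dot c x = 0}"

section \<open>The twisted cubic, its osculating planes and tangents (None = infinity)\<close>

definition cvec :: "'a::field option \<Rightarrow> 'a vec" where
  "cvec t = (case t of Some s \<Rightarrow> vec4 (s^3) (s^2) s 1 | None \<Rightarrow> vec4 1 0 0 0)"

definition cpt :: "'a::field option \<Rightarrow> 'a vec set" where "cpt t = pt (cvec t)"

definition twisted_cubic :: "'a::field vec set set" where "twisted_cubic = range cpt"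

definition osc_coef :: "'a::field option \<Rightarrow> 'a vec" where
  "osc_coef t = (case t of Some s \<Rightarrow> vec4 1 (-3*s) (3*s^2) (-(s^3)) | None \<Rightarrow> vec4 0 0 0 1)"

definition osc :: "'a::field option \<Rightarrow> 'a vec set set" where "osc t = plane (osc_coef t)"

definition tangent :: "'a::field option \<Rightarrow> 'a vec set set" where
  "tangent t = (case t of Some s \<Rightarrow> line_through (cvec (Some s)) (vec4 (3*s^2) (2*s) 1 0)
                 | None \<Rightarrow> line_through (vec4 1 0 0 0) (vec4 0 1 0 0))"

type_synonym 'a mat = "idx \<Rightarrow> idx \<Rightarrow> 'a"

definition vmat :: "'a::comm_ring_1 vec \<Rightarrow> 'a mat \<Rightarrow> 'a vec" where
  "vmat x M = (\<lambda>j. \<Sum>i\<in>UNIV. x i * M i j)"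

definition mmul :: "'a::comm_ring_1 mat \<Rightarrow> 'a mat \<Rightarrow> 'a mat" where
  "mmul M N = (\<lambda>i k. \<Sum>j\<in>UNIV. M i j * N j k)"

definition idm :: "'a::comm_ring_1 mat" where "idm = (\<lambda>i j. if i = j then 1 else 0)"

definition invertible_mat :: "'a::comm_ring_1 mat \<Rightarrow> bool" where
  "invertible_mat M \<longleftrightarrow> (\<exists>N. mmul M N = idm \<and> mmul N M = idm)"

definition pmap :: "'a::field mat \<Rightarrow> 'a vec set \<Rightarrow> 'a vec set" where
  "pmap M p = (\<lambda>x. vmat x M) ` p"

definition lmap :: "'a::field mat \<Rightarrow> 'a vec set set \<Rightarrow> 'a vec set set" where
  "lmap M l = pmap M ` l"

definition Gq :: "'a::field mat set" where
  "Gq = {M. invertible_mat M \<and> pmap M ` twisted_cubic = twisted_cubic}"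

definition Mstar :: "'a::field \<Rightarrow> 'a \<Rightarrow> 'a \<Rightarrow> 'a \<Rightarrow> 'a mat" where
  "Mstar a b c d = (\<lambda>i j. case i of
      X0 \<Rightarrow> (case j of X0 \<Rightarrow> a^3 | X1 \<Rightarrow> a^2*c | X2 \<Rightarrow> a*c^2 | X3 \<Rightarrow> c^3)
    | X1 \<Rightarrow> (case j of X0 \<Rightarrow> 3*a^2*b | X1 \<Rightarrow> a^2*d + 2*a*b*c | X2 \<Rightarrow> b*c^2 + 2*a*c*d | X3 \<Rightarrow> 3*c^2*d)
    | X2 \<Rightarrow> (case j of X0 \<Rightarrow> 3*a*b^2 | X1 \<Rightarrow> b^2*c + 2*a*b*d | X2 \<Rightarrow> a*d^2 + 2*b*c*d | X3 \<Rightarrow> 3*c*d^2)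
    | X3 \<Rightarrow> (case j of X0 \<Rightarrow> b^3 | X1 \<Rightarrow> b^2*d | X2 \<Rightarrow> b*d^2 | X3 \<Rightarrow> d^3))"

definition Gq_star :: "'a::field mat set" where
  "Gq_star = {Mstar a b c d | a b c d. a*d - b*c \<noteq> 0}"

definition line_orbit :: "'a::field mat set \<Rightarrow> 'a vec set set \<Rightarrow> 'a vec set set set" where
  "line_orbit G l = (\<lambda>M. lmap M l) ` G"

definition line_orbits :: "'a::field mat set \<Rightarrow> 'a vec set set set set" where
  "line_orbits G = line_orbit G ` lines"

definition RC_lines :: "gf4 vec set set set" where
  "RC_lines = {l \<in> lines. \<exists>s t. s \<noteq> t \<and> cpt s \<in> l \<and> cpt t \<in> l}"

definition Tr_lines :: "gf4 vec set set set" where "Tr_lines = range tangent"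

definition RA_lines :: "gf4 vec set set set" where
  "RA_lines = {osc s \<inter> osc t | s t. s \<noteq> t}"

text \<open>Imaginary chord / axis: the F_4-rational points of the line of PG(3,16) through
  P(alpha), P(alpha^4), resp. of the intersection of the planes osc(alpha), osc(alpha^4).\<close>
definition ic_line :: "gf16 \<Rightarrow> gf4 vec set set" where
  "ic_line \<alpha> = {pt x | x. x \<noteq> zvec \<and>
     (\<exists>a b. emb \<circ> x = vadd (smul a (cvec (Some \<alpha>))) (smul b (cvec (Some (\<alpha>^4)))))}"

definition ia_line :: "gf16 \<Rightarrow> gf4 vec set set" where
  "ia_line \<alpha> = {pt x | x. x \<noteq> zvec \<and>
     dot (osc_coef (Some \<alpha>)) (emb \<circ> x) = 0 \<and> dot (osc_coef (Some (\<alpha>^4))) (emb \<circ> x) = 0}"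

definition IC_lines :: "gf4 vec set set set" where
  "IC_lines = {ic_line \<alpha> | \<alpha>. \<alpha> \<notin> range emb}"

definition IA_lines :: "gf4 vec set set set" where
  "IA_lines = {ia_line \<alpha> | \<alpha>. \<alpha> \<notin> range emb}"

definition unisecant :: "gf4 vec set set \<Rightarrow> bool" where
  "unisecant l \<longleftrightarrow> l \<in> lines \<and> card (l \<inter> twisted_cubic) = 1"

definition external :: "gf4 vec set set \<Rightarrow> bool" where
  "external l \<longleftrightarrow> l \<in> lines \<and> l \<inter> twisted_cubic = {}"

definition UG_lines :: "gf4 vec set set set" where
  "UG_lines = {l. unisecant l \<and> l \<notin> Tr_lines \<and> (\<exists>t. l \<subseteq> osc t)}"

definition UnG_lines :: "gf4 vec set set set" where
  "UnG_lines = {l. unisecant l \<and> \<not> (\<exists>t. l \<subseteq> osc t)}"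

definition EG_lines :: "gf4 vec set set set" where
  "EG_lines = {l. external l \<and> (\<exists>!t. l \<subseteq> osc t)}"

definition EnG_lines :: "gf4 vec set set set" where
  "EnG_lines = {l. external l \<and> \<not> (\<exists>t. l \<subseteq> osc t) \<and> l \<notin> IC_lines \<and> l \<notin> IA_lines}"

definition ell1 :: "gf4 \<Rightarrow> gf4 vec set set" where
  "ell1 \<xi> = plane (vec4 0 0 1 0) \<inter> plane (vec4 1 0 0 (-\<xi>))"

definition ell2 :: "gf4 \<Rightarrow> gf4 vec set set" where
  "ell2 \<xi> = plane (vec4 0 1 0 0) \<inter> plane (vec4 1 0 0 (-\<xi>))"

end

theory Submission
  imports Defs
begin

text \<open>
  The five points of the twisted cubic form a frame of \<open>PG(3,4)\<close>, and the vectors \<open>cvec t\<close> sum to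
  zero.  Hence an element of \<open>G\<^sub>4\<close> is determined up to a scalar by the permutation it induces on the
  cubic, and \<open>G\<^sub>4\<close> acts as the symmetric group on five points: it is the union of \<open>G\<^sub>4\<^sup>*\<close> and its coset
  of the map exchanging \<open>x\<^sub>1\<close> and \<open>x\<^sub>2\<close>, which acts on the cubic as the Frobenius map \<open>t \<mapsto> t\<^sup>2\<close>.  The
  357 lines are encoded by their reduced echelon bases; on these codes the two groups act by 60
  explicit matrices and one additional involution, so that the orbits and the line types become a
  finite computation.
\<close>

section \<open>Vectors, points and lines\<close>

text \<open>What singles out q = 4 is the count q + 1 = 5: the cubic is exactly as large as a frame,
  so every permutation of its points comes from a projectivity, while \<open>Gq_star\<close> induces
  only the even ones. Index two dictates the shape of the answer: an orbit of \<open>Gq\<close> is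
  either one orbit of \<open>Gq_star\<close> or the union of two of equal size that are exchanged by
  a single involution. Two obstacles shape the work. \<open>Gq\<close> is a set of matrices, closed
  under nonzero scalar multiples, whereas \<open>Gq_star\<close> holds one matrix for each
  projectivity; the scalar has to be split off before anything becomes finite. And lines are sets of
  sets of functions, which cannot be evaluated; they are replaced by bases over the datatype
  \<open>row\<close>, made canonical through Pluecker coordinates. As these coordinates change only
  by a common factor under a change of basis, one normal form shows both that every line has a code
  and that no line has two.\<close>

lemma sum_idx: "(\<Sum>i\<in>UNIV. f i) = f X0 + f X1 + f X2 + f X3"
  by (simp add: UNIV_idx add.assoc)

lemma all_idx: "(\<forall>i. P i) \<longleftrightarrow> P X0 \<and> P X1 \<and> P X2 \<and> P X3"
  by (metis idx.exhaust)

lemma vec_eq_iff: "u = v \<longleftrightarrow> u X0 = v X0 \<and> u X1 = v X1 \<and> u X2 = v X2 \<and> u X3 = v X3"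
  by (simp add: fun_eq_iff all_idx)

lemma vec4_simps [simp]:
  "vec4 a b c d X0 = a" "vec4 a b c d X1 = b" "vec4 a b c d X2 = c" "vec4 a b c d X3 = d"
  by (simp_all add: vec4_def)

lemma vec_expand: "vec4 (v X0) (v X1) (v X2) (v X3) = v"
  by (simp add: vec_eq_iff)

lemma vmat_vadd: "vmat (vadd u v) M = vadd (vmat u M) (vmat v M)"
  by (simp add: vmat_def vadd_def sum.distrib algebra_simps)

lemma vmat_smul: "vmat (smul c v) M = smul c (vmat v M)"
  by (simp add: vmat_def smul_def sum_distrib_left algebra_simps)

lemma vmat_mmul: "vmat x (mmul M N) = vmat (vmat x M) N"
  by (simp add: vmat_def mmul_def sum_idx algebra_simps)

lemma vmat_idm: "vmat x idm = x"
  by (simp add: vmat_def idm_def sum_idx vec_eq_iff)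

lemma smul_smul: "smul a (smul b v) = smul (a * b) (v :: 'a::semigroup_mult vec)"
  by (simp add: smul_def mult.assoc)

lemma smul_one [simp]: "smul (1::'a::monoid_mult) v = v"
  by (simp add: smul_def)

lemma smul_eq_zvec: "smul c v = zvec \<longleftrightarrow> c = 0 \<or> v = zvec" for c :: "'a::field"
  by (auto simp: smul_def zvec_def fun_eq_iff)

lemma pt_self: "v \<in> pt v"
  by (auto simp: pt_def intro!: exI[of _ 1])

lemma pt_smul:
  assumes "c \<noteq> 0"
  shows "pt (smul c v) = pt v"
proof
  show "pt (smul c v) \<subseteq> pt v"
    using assms by (auto simp: pt_def smul_smul)
  show "pt v \<subseteq> pt (smul c v)"
  proof
    fix x assume "x \<in> pt v"
    then obtain d where d: "d \<noteq> 0" "x = smul d v" by (auto simp: pt_def)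
    have "x = smul (d / c) (smul c v)" "d / c \<noteq> 0"
      using assms d by (simp_all add: smul_smul)
    then show "x \<in> pt (smul c v)" unfolding pt_def by blast
  qed
qed

lemma pt_eq_iff: "pt u = pt v \<longleftrightarrow> (\<exists>c. c \<noteq> 0 \<and> u = smul c v)"
proof
  assume "pt u = pt v"
  then have "u \<in> pt v" using pt_self by metis
  then show "\<exists>c. c \<noteq> 0 \<and> u = smul c v" by (auto simp: pt_def)
qed (auto simp: pt_smul)

lemma pmap_pt: "pmap M (pt v) = pt (vmat v M)"
proof
  show "pmap M (pt v) \<subseteq> pt (vmat v M)"
    by (auto simp: pmap_def pt_def vmat_smul)
  show "pt (vmat v M) \<subseteq> pmap M (pt v)"
  proof
    fix x assume "x \<in> pt (vmat v M)"
    then obtain c where "c \<noteq> 0" "x = vmat (smul c v) M" by (auto simp: pt_def vmat_smul)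
    then show "x \<in> pmap M (pt v)" by (auto simp: pmap_def pt_def)
  qed
qed

text \<open>Lines and planes are sets of points \<open>pt x\<close> with a condition on the
  representative x. When the condition is invariant under scaling, it can be read off any
  representative.\<close>

lemma pt_set_mem_iff:
  assumes "\<And>c x. c \<noteq> 0 \<Longrightarrow> P (smul c x) \<longleftrightarrow> P x"
  shows "pt w \<in> {pt x | x. x \<noteq> zvec \<and> P x} \<longleftrightarrow> w \<noteq> zvec \<and> P w"
proof
  assume "pt w \<in> {pt x | x. x \<noteq> zvec \<and> P x}"
  then obtain x where x: "x \<noteq> zvec" "P x" "pt w = pt x" by auto
  then obtain c where "c \<noteq> 0" "w = smul c x" by (auto simp: pt_eq_iff)
  with x assms show "w \<noteq> zvec \<and> P w" by (auto simp: smul_eq_zvec)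
qed auto

definition lincomb :: "'a::field vec \<Rightarrow> 'a vec \<Rightarrow> 'a \<Rightarrow> 'a \<Rightarrow> 'a vec" where
  "lincomb u v a b = vadd (smul a u) (smul b v)"

lemma lincomb_apply: "lincomb u v a b i = a * u i + b * v i"
  by (simp add: lincomb_def vadd_def smul_def)

lemma smul_lincomb: "smul c (lincomb u v a b) = lincomb u v (c * a) (c * b)"
  by (simp add: fun_eq_iff lincomb_apply) (simp add: smul_def lincomb_apply algebra_simps)

lemma lincomb_lincomb:
  "lincomb (lincomb u v a b) (lincomb u v c d) x y = lincomb u v (x * a + y * c) (x * b + y * d)"
  by (simp add: fun_eq_iff lincomb_apply algebra_simps)

lemma lincomb_unit: "lincomb u v 1 0 = u" "lincomb u v 0 1 = v"
  by (simp_all add: fun_eq_iff lincomb_apply)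

lemma line_through_alt: "line_through u v = {pt x | x. x \<noteq> zvec \<and> (\<exists>a b. x = lincomb u v a b)}"
  unfolding line_through_def lincomb_def by blast

lemma pt_in_line_iff:
  "pt w \<in> line_through u v \<longleftrightarrow> w \<noteq> zvec \<and> (\<exists>a b. w = lincomb u v a b)"
  unfolding line_through_alt
proof (rule pt_set_mem_iff)
  fix c :: 'a and x assume c: "c \<noteq> 0"
  have x: "x = smul (inverse c) (smul c x)" using c by (simp add: smul_smul)
  show "(\<exists>a b. smul c x = lincomb u v a b) \<longleftrightarrow> (\<exists>a b. x = lincomb u v a b)"
    using x by (metis smul_lincomb)
qed

text \<open>The 2 x 2 minors of the matrix with rows u and v, that is, the Pluecker coordinates of
  the line, for all ordered pairs of indices.\<close>

definition plucker :: "'a::field vec \<Rightarrow> 'a vec \<Rightarrow> idx \<Rightarrow> idx \<Rightarrow> 'a" where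
  "plucker u v i j = u i * v j - u j * v i"

definition independent :: "'a::field vec \<Rightarrow> 'a vec \<Rightarrow> bool" where
  "independent u v \<longleftrightarrow> (\<exists>i j. plucker u v i j \<noteq> 0)"

lemma independent_iff: "independent u v \<longleftrightarrow> u \<noteq> zvec \<and> v \<noteq> zvec \<and> pt u \<noteq> pt v"
proof
  assume "independent u v"
  then show "u \<noteq> zvec \<and> v \<noteq> zvec \<and> pt u \<noteq> pt v"
    by (auto simp: independent_def plucker_def zvec_def pt_eq_iff smul_def)
next
  assume uv: "u \<noteq> zvec \<and> v \<noteq> zvec \<and> pt u \<noteq> pt v"
  show "independent u v"
  proof (rule ccontr)
    assume "\<not> independent u v"
    then have p: "u i * v j = u j * v i" for i j by (simp add: independent_def plucker_def)
    obtain k where k: "v k \<noteq> 0" using uv by (auto simp: zvec_def)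
    have u: "u = smul (u k / v k) v"
      using k p by (simp add: smul_def fun_eq_iff field_simps)
    then have "u k / v k \<noteq> 0" using uv smul_eq_zvec by metis
    then show False using u uv pt_eq_iff by blast
  qed
qed

lemma lines_alt: "lines = {line_through u v | u v. independent u v}"
  unfolding lines_def independent_iff by blast

text \<open>All minors are multiplied by the determinant of the change of basis, so up to a common
  factor they depend only on the line.\<close>

lemma plucker_lincomb:
  "plucker (lincomb u v a b) (lincomb u v c d) i j = (a * d - b * c) * plucker u v i j"
  by (simp add: plucker_def lincomb_apply algebra_simps)

lemma line_through_lincomb:
  assumes "a * d - b * c \<noteq> 0"
  shows "line_through (lincomb u v a b) (lincomb u v c d) = line_through u v"
proof -
  let ?D = "a * d - b * c"
  have "(\<exists>x y. w = lincomb (lincomb u v a b) (lincomb u v c d) x y) \<longleftrightarrow> (\<exists>x y. w = lincomb u v x y)" for w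
  proof
    assume "\<exists>x y. w = lincomb u v x y"
    then obtain x y where w: "w = lincomb u v x y" by blast
    \<comment> \<open>Cramer's rule for the coefficients of w in the new basis, first without
      denominators.\<close>
    have "x * ?D = (x * d - y * c) * a + (y * a - x * b) * c"
      "y * ?D = (x * d - y * c) * b + (y * a - x * b) * d"
      by (simp_all add: algebra_simps)
    then have "x = ((x * d - y * c) * a + (y * a - x * b) * c) / ?D"
      "y = ((x * d - y * c) * b + (y * a - x * b) * d) / ?D"
      using assms by (simp_all add: eq_divide_eq)
    then have "w = lincomb (lincomb u v a b) (lincomb u v c d) ((x * d - y * c) / ?D) ((y * a - x * b) / ?D)"
      by (simp add: lincomb_lincomb w flip: add_divide_distrib)
    then show "\<exists>x y. w = lincomb (lincomb u v a b) (lincomb u v c d) x y" by blast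
  qed (auto simp: lincomb_lincomb)
  then show ?thesis by (simp add: line_through_alt)
qed

lemma line_through_eqD:
  assumes "line_through u v = line_through u' v'" "independent u' v'"
  shows "\<exists>a b c d. a * d - b * c \<noteq> 0 \<and> u' = lincomb u v a b \<and> v' = lincomb u v c d"
proof -
  have "pt u' \<in> line_through u' v'" "pt v' \<in> line_through u' v'"
    using assms(2) unfolding pt_in_line_iff independent_iff by (metis lincomb_unit)+
  then obtain a b c d where e: "u' = lincomb u v a b" "v' = lincomb u v c d"
    unfolding assms(1)[symmetric] pt_in_line_iff by blast
  moreover from assms(2) have "a * d - b * c \<noteq> 0"
    by (auto simp: independent_def e plucker_lincomb)
  ultimately show ?thesis by blast
qed

lemma vmat_lincomb: "vmat (lincomb u v a b) M = lincomb (vmat u M) (vmat v M) a b"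
  by (simp add: lincomb_def vmat_vadd vmat_smul)

lemma inj_vmat:
  assumes "invertible_mat M"
  shows "inj (\<lambda>x. vmat x M)"
proof -
  obtain N where "mmul M N = idm" using assms unfolding invertible_mat_def by blast
  then have "vmat (vmat x M) N = x" for x by (simp add: vmat_idm flip: vmat_mmul)
  then show ?thesis by (intro inj_on_inverseI[where g = "\<lambda>y. vmat y N"])
qed

lemma vmat_zvec: "vmat zvec M = zvec"
  by (simp add: vmat_def zvec_def)

lemma vmat_eq_zvec_iff: "invertible_mat M \<Longrightarrow> vmat x M = zvec \<longleftrightarrow> x = zvec"
  using inj_eq[OF inj_vmat, of M x zvec] by (simp add: vmat_zvec)

lemma lmap_line_through:
  assumes "invertible_mat M"
  shows "lmap M (line_through u v) = line_through (vmat u M) (vmat v M)"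
proof
  show "lmap M (line_through u v) \<subseteq> line_through (vmat u M) (vmat v M)"
  proof
    fix p assume "p \<in> lmap M (line_through u v)"
    then obtain a b where ab: "lincomb u v a b \<noteq> zvec" "p = pt (vmat (lincomb u v a b) M)"
      by (auto simp: lmap_def line_through_alt pmap_pt)
    then have "vmat (lincomb u v a b) M \<noteq> zvec" by (simp add: vmat_eq_zvec_iff assms)
    then show "p \<in> line_through (vmat u M) (vmat v M)"
      by (auto simp: ab(2) pt_in_line_iff vmat_lincomb)
  qed
  show "line_through (vmat u M) (vmat v M) \<subseteq> lmap M (line_through u v)"
  proof
    fix p assume "p \<in> line_through (vmat u M) (vmat v M)"
    then obtain a b where ab: "vmat (lincomb u v a b) M \<noteq> zvec" "p = pmap M (pt (lincomb u v a b))"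
      by (auto simp: line_through_alt pmap_pt vmat_lincomb)
    then have "pt (lincomb u v a b) \<in> line_through u v"
      by (auto simp: pt_in_line_iff vmat_eq_zvec_iff assms)
    then show "p \<in> lmap M (line_through u v)"
      by (simp add: lmap_def ab(2))
  qed
qed

lemma inj_pmap: "invertible_mat M \<Longrightarrow> inj (pmap M)"
  by (rule injI) (simp add: pmap_def inj_image_eq_iff[OF inj_vmat])

lemma independent_vmat:
  assumes "invertible_mat M" "independent u v"
  shows "independent (vmat u M) (vmat v M)"
  using assms unfolding independent_iff
  by (simp add: vmat_eq_zvec_iff inj_eq[OF inj_pmap] flip: pmap_pt)

section \<open>The stabiliser of the twisted cubic\<close>

lemma pmap_mmul: "pmap (mmul M N) p = pmap N (pmap M p)"
  by (simp add: pmap_def image_image vmat_mmul)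

lemma lmap_mmul: "lmap (mmul M N) l = lmap N (lmap M l)"
  by (simp add: lmap_def image_image pmap_mmul)

lemma pmap_idm: "pmap idm p = p"
  by (simp add: pmap_def vmat_idm)

lemma lmap_idm: "lmap idm l = l"
  by (simp add: lmap_def pmap_idm)

lemma mmul_assoc: "mmul (mmul L M) N = mmul L (mmul M N)"
  by (simp add: mmul_def sum_idx fun_eq_iff algebra_simps)

lemma mmul_idm: "mmul idm M = M" "mmul M idm = M"
  by (simp_all add: mmul_def idm_def sum_idx fun_eq_iff all_idx)

lemma invertible_mmul:
  assumes "invertible_mat M" "invertible_mat N"
  shows "invertible_mat (mmul M N)"
proof -
  obtain M' where M: "mmul M M' = idm" "mmul M' M = idm"
    using assms(1) unfolding invertible_mat_def by blast
  obtain N' where N: "mmul N N' = idm" "mmul N' N = idm"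
    using assms(2) unfolding invertible_mat_def by blast
  have "mmul (mmul M N) (mmul N' M') = mmul M (mmul (mmul N N') M')"
    "mmul (mmul N' M') (mmul M N) = mmul N' (mmul (mmul M' M) N)"
    by (simp_all add: mmul_assoc)
  then show ?thesis unfolding invertible_mat_def by (metis M N mmul_idm)
qed

lemma Gq_mmul: "M \<in> Gq \<Longrightarrow> N \<in> Gq \<Longrightarrow> mmul M N \<in> Gq"
proof -
  assume "M \<in> Gq" "N \<in> Gq"
  moreover have "pmap (mmul M N) ` twisted_cubic = pmap N ` pmap M ` twisted_cubic"
    by (simp add: image_image pmap_mmul)
  ultimately show ?thesis by (simp add: Gq_def invertible_mmul)
qed

lemma Gq_inverse:
  assumes "M \<in> Gq"
  obtains N where "N \<in> Gq" "mmul M N = idm"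
proof -
  obtain N where N: "mmul M N = idm" "mmul N M = idm"
    using assms unfolding Gq_def invertible_mat_def by blast
  have "pmap N ` twisted_cubic = pmap N ` pmap M ` twisted_cubic"
    using assms by (simp add: Gq_def)
  also have "\<dots> = twisted_cubic"
    by (simp add: image_image N pmap_idm flip: pmap_mmul)
  finally have "N \<in> Gq" using N by (auto simp: Gq_def invertible_mat_def)
  with N that show ?thesis by blast
qed

lemma line_orbit_Gq_subset:
  assumes "M \<in> Gq"
  shows "line_orbit Gq (lmap M l) \<subseteq> line_orbit Gq l"
  using Gq_mmul[OF assms] by (auto simp: line_orbit_def simp flip: lmap_mmul)

lemma line_orbit_Gq_eq:
  assumes "l' \<in> line_orbit Gq l"
  shows "line_orbit Gq l' = line_orbit Gq l"
proof -
  obtain M where M: "M \<in> Gq" "l' = lmap M l" using assms by (auto simp: line_orbit_def)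
  obtain N where N: "N \<in> Gq" "mmul M N = idm" using Gq_inverse M(1) by blast
  have "line_orbit Gq l' \<subseteq> line_orbit Gq l"
    unfolding M(2) by (rule line_orbit_Gq_subset[OF M(1)])
  moreover have "lmap N l' = l" by (simp add: M N lmap_idm flip: lmap_mmul)
  then have "line_orbit Gq l \<subseteq> line_orbit Gq l'"
    using line_orbit_Gq_subset[OF N(1), of l'] by simp
  ultimately show ?thesis by blast
qed

lemma inj_cpt: "inj cpt"
  by (auto simp: inj_def cpt_def pt_eq_iff vec_eq_iff cvec_def smul_def split: option.splits)

text \<open>An injective map of the finite cubic into itself is onto, so it is enough to follow each
  point. The scalar k is there because an image is only known projectively.\<close>

lemma Gq_memI:
  fixes M :: "'a::{field,finite} mat"
  assumes "invertible_mat M"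
    and "\<And>t. \<exists>k t'. k \<noteq> 0 \<and> vmat (cvec t) M = smul k (cvec t')"
  shows "M \<in> Gq"
proof -
  have sub: "pmap M ` twisted_cubic \<subseteq> twisted_cubic"
  proof clarsimp
    fix p :: "'a vec set" assume "p \<in> twisted_cubic"
    then obtain t where p: "p = cpt t" by (auto simp: twisted_cubic_def)
    obtain k t' where "k \<noteq> 0" "vmat (cvec t) M = smul k (cvec t')" using assms(2) by blast
    then have "pmap M p = cpt t'" by (simp add: p cpt_def pmap_pt pt_smul)
    then show "pmap M p \<in> twisted_cubic" by (simp add: twisted_cubic_def)
  qed
  have "finite (twisted_cubic :: 'a vec set set)" by (simp add: twisted_cubic_def)
  then have "pmap M ` twisted_cubic = twisted_cubic"
    using sub inj_pmap[OF assms(1)] by (meson endo_inj_surj inj_on_subset subset_UNIV)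
  then show ?thesis using assms(1) by (simp add: Gq_def)
qed

text \<open>\<open>Mstar\<close> is the symmetric cube of a 2 x 2 matrix. Multiplying by the
  symmetric cube of the adjugate gives that of a scalar matrix, whence the cube of the
  determinant.\<close>

lemma mmul_Mstar_adjugate:
  "mmul (Mstar a b c d) (Mstar d (-b) (-c) a) = (\<lambda>i j. (a * d - b * c) ^ 3 * idm i j)"
  by (simp add: fun_eq_iff all_idx mmul_def sum_idx Mstar_def idm_def power3_eq_cube power2_eq_square)
    (simp add: algebra_simps)

section \<open>Lines of \<open>PG(3,4)\<close> in echelon form\<close>

lemma gf4_diff [simp]: "x - y = x + y" for x y :: gf4
  by (simp add: minus_gf4_def)

lemma gf4_uminus [simp]: "- x = x" for x :: gf4
  by (simp add: uminus_gf4_def)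

lemma gf4_add_left_cancel [simp]: "x + (x + y) = y" for x y :: gf4
  by (simp add: add_self flip: add.assoc)

declare add_self [simp]

lemma gf4_two: "2 = (0::gf4)"
  using add_self[of "1::gf4"] unfolding one_add_one .

lemma gf4_three: "3 = (1::gf4)"
  using gf4_two by (metis add_0 numeral_plus_one semiring_norm(5) add.commute)

lemma gf4_cube: "x \<noteq> 0 \<Longrightarrow> x * (x * x) = 1" for x :: gf4
  by (cases x) (simp_all add: zero_gf4_def one_gf4_def)

lemma ex_idx: "(\<exists>i. P i) \<longleftrightarrow> P X0 \<or> P X1 \<or> P X2 \<or> P X3"
  by (metis idx.exhaust)

datatype row = Row gf4 gf4 gf4 gf4
datatype rmat = Rmat row row row row

fun row_vec :: "row \<Rightarrow> gf4 vec" where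
  "row_vec (Row a b c d) = vec4 a b c d"

fun mat_of :: "rmat \<Rightarrow> gf4 mat" where
  "mat_of (Rmat p q r s) = (\<lambda>i. case i of X0 \<Rightarrow> row_vec p | X1 \<Rightarrow> row_vec q | X2 \<Rightarrow> row_vec r | X3 \<Rightarrow> row_vec s)"

fun radd :: "row \<Rightarrow> row \<Rightarrow> row" where
  "radd (Row a b c d) (Row e f g h) = Row (a + e) (b + f) (c + g) (d + h)"

fun rscale :: "gf4 \<Rightarrow> row \<Rightarrow> row" where
  "rscale k (Row a b c d) = Row (k * a) (k * b) (k * c) (k * d)"

fun rapp :: "rmat \<Rightarrow> row \<Rightarrow> row" where
  "rapp (Rmat p q r s) (Row a b c d) =
     radd (radd (rscale a p) (rscale b q)) (radd (rscale c r) (rscale d s))"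

fun rdot :: "row \<Rightarrow> row \<Rightarrow> gf4" where
  "rdot (Row a b c d) (Row e f g h) = a * e + b * f + c * g + d * h"

lemma row_vec_inject [simp]: "row_vec r = row_vec s \<longleftrightarrow> r = s"
  by (cases r; cases s) (auto simp: vec_eq_iff)

lemma row_vec_surj: "\<exists>r. row_vec r = v"
  by (rule exI[of _ "Row (v X0) (v X1) (v X2) (v X3)"]) (simp add: vec_expand)

lemma row_vec_radd: "row_vec (radd r s) = vadd (row_vec r) (row_vec s)"
  by (cases r; cases s) (simp add: vec_eq_iff vadd_def)

lemma row_vec_rscale: "row_vec (rscale k r) = smul k (row_vec r)"
  by (cases r) (simp add: vec_eq_iff smul_def)

lemma dot_row_vec: "dot (row_vec r) (row_vec s) = rdot r s"
  by (cases r; cases s) (simp add: dot_def sum_idx)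

lemma vmat_row_vec: "vmat (row_vec r) (mat_of m) = row_vec (rapp m r)"
  by (cases m; cases r)
    (simp add: row_vec_radd row_vec_rscale, simp add: fun_eq_iff vmat_def sum_idx vadd_def smul_def add.assoc)

text \<open>The arguments of \<open>pech\<close> are the Pluecker coordinates \<open>p\<^sub>2\<^sub>3, p\<^sub>1\<^sub>3, p\<^sub>0\<^sub>3, p\<^sub>1\<^sub>2, p\<^sub>0\<^sub>2, p\<^sub>0\<^sub>1\<close> of a line; its
  value is the reduced basis whose pivots are the last possible pair of coordinates.\<close>

fun pech :: "gf4 \<Rightarrow> gf4 \<Rightarrow> gf4 \<Rightarrow> gf4 \<Rightarrow> gf4 \<Rightarrow> gf4 \<Rightarrow> row \<times> row" where
  "pech p23 p13 p03 p12 p02 p01 =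
    (if p23 \<noteq> 0 then
       (rscale (inverse p23) (Row p03 p13 p23 0), rscale (inverse p23) (Row p02 p12 0 p23))
     else if p13 \<noteq> 0 then
       (rscale (inverse p13) (Row p03 p13 0 0), rscale (inverse p13) (Row p01 0 p12 p13))
     else if p03 \<noteq> 0 then (Row 1 0 0 0, rscale (inverse p03) (Row 0 p01 p02 p03))
     else if p12 \<noteq> 0 then
       (rscale (inverse p12) (Row p02 p12 0 0), rscale (inverse p12) (Row p01 0 p12 0))
     else if p02 \<noteq> 0 then (Row 1 0 0 0, rscale (inverse p02) (Row 0 p01 p02 0))
     else (Row 1 0 0 0, Row 0 1 0 0))"

text \<open>The minors are written as sums because signs disappear in characteristic 2.\<close>

fun rech :: "row \<times> row \<Rightarrow> row \<times> row" where
  "rech (Row a b c d, Row e f g h) =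
     pech (c * h + d * g) (b * h + d * f) (a * h + d * e) (b * g + c * f) (a * g + c * e) (a * f + b * e)"

definition line_of :: "row \<times> row \<Rightarrow> gf4 vec set set" where
  "line_of c = line_through (row_vec (fst c)) (row_vec (snd c))"

definition gfs :: "gf4 list" where "gfs = [G0, G1, Ga, Gb]"

lemma set_gfs [simp]: "set gfs = UNIV"
  by (simp add: gfs_def UNIV_gf4)

text \<open>One block for each pivot pair, that is, for each Schubert cell: 256 + 64 + 16 + 16 + 4 +
  1 = 357 = (4^2 + 1)(4^2 + 4 + 1).\<close>

definition line_codes :: "(row \<times> row) list" where
  "line_codes =
     map (\<lambda>(a, b, c, d). (Row a b 1 0, Row c d 0 1)) (List.product gfs (List.product gfs (List.product gfs gfs))) @
     map (\<lambda>(a, b, c). (Row a 1 0 0, Row b 0 c 1)) (List.product gfs (List.product gfs gfs)) @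
     map (\<lambda>(a, b). (Row 1 0 0 0, Row 0 a b 1)) (List.product gfs gfs) @
     map (\<lambda>(a, b). (Row a 1 0 0, Row b 0 1 0)) (List.product gfs gfs) @
     map (\<lambda>a. (Row 1 0 0 0, Row 0 a 1 0)) gfs @
     [(Row 1 0 0 0, Row 0 1 0 0)]"

lemma rech_plucker:
  "rech (r, s) = pech (plucker (row_vec r) (row_vec s) X2 X3) (plucker (row_vec r) (row_vec s) X1 X3)
     (plucker (row_vec r) (row_vec s) X0 X3) (plucker (row_vec r) (row_vec s) X1 X2)
     (plucker (row_vec r) (row_vec s) X0 X2) (plucker (row_vec r) (row_vec s) X0 X1)"
  by (cases r; cases s) (simp add: plucker_def)

lemma inverse_scale: "D \<noteq> 0 \<Longrightarrow> inverse (D * p) * (D * x) = inverse p * x" for D :: "'a::field"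
  by simp

lemma pech_scale:
  assumes "D \<noteq> 0"
  shows "pech (D * p23) (D * p13) (D * p03) (D * p12) (D * p02) (D * p01) = pech p23 p13 p03 p12 p02 p01"
  using assms inverse_scale[OF assms]
  by (simp del: inverse_mult_distrib)

text \<open>Every entry produced by \<open>pech\<close> is 0, 1 or a quotient of two coordinates, so
  the determinant of a change of basis cancels and the normal form belongs to the line, not to its
  basis.\<close>

lemma rech_lincomb:
  assumes "a * d - b * c \<noteq> 0"
    and "row_vec r' = lincomb (row_vec r) (row_vec s) a b"
    and "row_vec s' = lincomb (row_vec r) (row_vec s) c d"
  shows "rech (r', s') = rech (r, s)"
  unfolding rech_plucker assms(2,3) plucker_lincomb by (rule pech_scale[OF assms(1)])

text \<open>Both vectors are combinations of u and v, with determinant 1 /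
  \<open>plucker u v i j\<close>. In positions i and j they form the identity matrix, which makes
  them the reduced basis with pivots i and j.\<close>

lemma line_through_echelon:
  assumes "plucker u v i j \<noteq> 0"
  shows "line_through (\<lambda>m. plucker u v m j / plucker u v i j) (\<lambda>m. plucker u v i m / plucker u v i j) =
    line_through u v"
proof -
  let ?p = "plucker u v i j"
  have "(\<lambda>m. plucker u v m j / ?p) = lincomb u v (v j / ?p) (- u j / ?p)"
    "(\<lambda>m. plucker u v i m / ?p) = lincomb u v (- v i / ?p) (u i / ?p)"
    by (simp_all add: fun_eq_iff lincomb_apply plucker_def diff_divide_distrib mult.commute)
  moreover have "v j / ?p * (u i / ?p) - - u j / ?p * (- v i / ?p) \<noteq> 0"
  proof -
    have "v j / ?p * (u i / ?p) - - u j / ?p * (- v i / ?p) = ?p / (?p * ?p)"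
      by (simp add: plucker_def diff_divide_distrib mult.commute)
    with assms show ?thesis by simp
  qed
  ultimately show ?thesis by (simp add: line_through_lincomb)
qed

lemma line_of_rech:
  assumes "independent (row_vec (fst c)) (row_vec (snd c))"
  shows "line_of (rech c) = line_of c"
proof -
  obtain r s where c: "c = (r, s)" by (cases c)
  let ?p = "plucker (row_vec r) (row_vec s)"
  have flip: "?p j i = ?p i j" and diag: "?p i i = 0" for i j
    by (simp_all add: plucker_def)
  have flips: "?p X1 X0 = ?p X0 X1" "?p X2 X0 = ?p X0 X2" "?p X3 X0 = ?p X0 X3"
     "?p X2 X1 = ?p X1 X2" "?p X3 X1 = ?p X1 X3" "?p X3 X2 = ?p X2 X3"
    by (rule flip)+
  have "\<exists>i j. ?p i j \<noteq> 0 \<and> row_vec (fst (rech c)) = (\<lambda>m. ?p m j / ?p i j) \<and>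
      row_vec (snd (rech c)) = (\<lambda>m. ?p i m / ?p i j)" (is "\<exists>i j. ?E i j")
  proof -
    \<comment> \<open>The cases follow the tests in \<open>pech\<close>, the first nonzero minor
      giving the pivots. In the last case all minors vanish, against independence.\<close>
    consider (1) "?p X2 X3 \<noteq> 0" | (2) "?p X2 X3 = 0" "?p X1 X3 \<noteq> 0"
      | (3) "?p X2 X3 = 0" "?p X1 X3 = 0" "?p X0 X3 \<noteq> 0"
      | (4) "?p X2 X3 = 0" "?p X1 X3 = 0" "?p X0 X3 = 0" "?p X1 X2 \<noteq> 0"
      | (5) "?p X2 X3 = 0" "?p X1 X3 = 0" "?p X0 X3 = 0" "?p X1 X2 = 0" "?p X0 X2 \<noteq> 0"
      | (6) "?p X2 X3 = 0" "?p X1 X3 = 0" "?p X0 X3 = 0" "?p X1 X2 = 0" "?p X0 X2 = 0" "?p X0 X1 \<noteq> 0"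
      | (7) "?p X2 X3 = 0" "?p X1 X3 = 0" "?p X0 X3 = 0" "?p X1 X2 = 0" "?p X0 X2 = 0" "?p X0 X1 = 0"
      by blast
    then show ?thesis
    proof cases
      case 1 then have "?E X2 X3"
        by (simp add: c rech_plucker vec_eq_iff divide_inverse mult.commute diag flips)
      then show ?thesis by blast
    next
      case 2 then have "?E X1 X3"
        by (simp add: c rech_plucker vec_eq_iff divide_inverse mult.commute diag flips)
      then show ?thesis by blast
    next
      case 3 then have "?E X0 X3"
        by (simp add: c rech_plucker vec_eq_iff divide_inverse mult.commute diag flips)
      then show ?thesis by blast
    next
      case 4 then have "?E X1 X2"
        by (simp add: c rech_plucker vec_eq_iff divide_inverse mult.commute diag flips)
      then show ?thesis by blast
    next
      case 5 then have "?E X0 X2"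
        by (simp add: c rech_plucker vec_eq_iff divide_inverse mult.commute diag flips)
      then show ?thesis by blast
    next
      case 6 then have "?E X0 X1"
        by (simp add: c rech_plucker vec_eq_iff divide_inverse mult.commute diag flips)
      then show ?thesis by blast
    next
      case 7
      then have "?p i j = 0" for i j by (cases i; cases j) (simp_all add: diag flips)
      with assms show ?thesis by (simp add: c independent_def)
    qed
  qed
  then obtain i j where "?E i j" by blast
  then show ?thesis
    by (simp add: line_of_def line_through_echelon) (simp add: c)
qed

lemma rech_in_line_codes: "rech c \<in> set line_codes"
proof -
  have "pech p23 p13 p03 p12 p02 p01 \<in> set line_codes" for p23 p13 p03 p12 p02 p01
    by (simp add: line_codes_def image_iff)
  moreover obtain r s where "c = (r, s)" by (cases c)
  ultimately show ?thesis by (simp add: rech_plucker del: pech.simps)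
qed

lemma rech_line_code: "\<forall>c\<in>set line_codes. rech c = c"
  by code_simp

lemma independent_line_code:
  "c \<in> set line_codes \<Longrightarrow> independent (row_vec (fst c)) (row_vec (snd c))"
proof -
  assume "c \<in> set line_codes"
  then have "\<exists>i j. plucker (row_vec (fst c)) (row_vec (snd c)) i j = 1"
    by (auto simp: ex_idx line_codes_def plucker_def)
  then show ?thesis unfolding independent_def by (metis zero_neq_one)
qed

lemma lines_eq: "lines = line_of ` set line_codes"
proof
  show "lines \<subseteq> line_of ` set line_codes"
  proof
    fix l :: "gf4 vec set set" assume "l \<in> lines"
    then obtain u v where l: "l = line_through u v" "independent u v" by (auto simp: lines_alt)
    obtain r s where "u = row_vec r" "v = row_vec s" using row_vec_surj by metis
    with l have "l = line_of (rech (r, s))" by (subst line_of_rech) (simp_all add: line_of_def)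
    then show "l \<in> line_of ` set line_codes" using rech_in_line_codes by blast
  qed
  show "line_of ` set line_codes \<subseteq> lines"
    by (auto simp: line_of_def lines_alt intro!: exI independent_line_code)
qed

text \<open>Two bases of one line have the same normal form, and a code is its own normal
  form.\<close>

lemma inj_on_line_of: "inj_on line_of (set line_codes)"
proof
  fix c c' assume c: "c \<in> set line_codes" "c' \<in> set line_codes" and e: "line_of c = line_of c'"
  obtain r s r' s' where rs: "c = (r, s)" "c' = (r', s')" by (cases c; cases c')
  have "\<exists>x y z w. x * w - y * z \<noteq> 0 \<and> row_vec r' = lincomb (row_vec r) (row_vec s) x y
      \<and> row_vec s' = lincomb (row_vec r) (row_vec s) z w"
    by (rule line_through_eqD) (use e independent_line_code[OF c(2)] in \<open>simp_all add: line_of_def rs\<close>)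
  then have "rech (r', s') = rech (r, s)" using rech_lincomb by blast
  then show "c = c'" using c rech_line_code by (simp add: rs)
qed

lemma gf4_add_eq_0: "x + y = 0 \<longleftrightarrow> x = y" for x y :: gf4
  using right_minus_eq[of x y] by simp

section \<open>The critical subgroup as a list of sixty matrices\<close>

definition mst :: "gf4 \<Rightarrow> gf4 \<Rightarrow> gf4 \<Rightarrow> gf4 \<Rightarrow> rmat" where
  "mst a b c d = Rmat (Row (a*a*a) (a*a*c) (a*c*c) (c*c*c)) (Row (a*a*b) (a*a*d) (b*c*c) (c*c*d))
     (Row (a*b*b) (b*b*c) (a*d*d) (c*d*d)) (Row (b*b*b) (b*b*d) (b*d*d) (d*d*d))"

text \<open>Scaling \<open>(a, b, c, d)\<close> does not change the matrix because cubes of nonzero elements are 1.\<close>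

definition msts :: "rmat list" where
  "msts = concat (map (\<lambda>b. concat (map (\<lambda>c. map (mst 1 b c) (filter (\<lambda>d. d \<noteq> b * c) gfs)) gfs)) gfs)
     @ concat (map (\<lambda>c. map (mst 0 1 c) gfs) [G1, Ga, Gb])"

definition frob :: rmat where
  "frob = Rmat (Row 1 0 0 0) (Row 0 0 1 0) (Row 0 1 0 0) (Row 0 0 0 1)"

lemma Mstar_eq_mat_of: "Mstar a b c d = mat_of (mst a b c d)"
  by (simp add: fun_eq_iff all_idx Mstar_def mst_def gf4_two gf4_three power2_eq_square
      power3_eq_cube)

lemma mst_in_msts:
  "\<forall>(a, b, c, d)\<in>set (List.product gfs (List.product gfs (List.product gfs gfs))).
     a * d + b * c \<noteq> 0 \<longrightarrow> mst a b c d \<in> set msts"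
  by code_simp

lemma Gq_star_eq: "Gq_star = mat_of ` set msts"
proof
  show "Gq_star \<subseteq> mat_of ` set msts"
    using mst_in_msts by (auto simp: Gq_star_def Mstar_eq_mat_of)
  show "mat_of ` set msts \<subseteq> Gq_star"
  proof clarify
    fix m assume "m \<in> set msts"
    then consider b c d where "m = mst 1 b c d" "d \<noteq> b * c" | c d where "m = mst 0 1 c d" "c \<noteq> 0"
      by (auto simp: msts_def zero_gf4_def)
    then have "\<exists>a b c d. m = mst a b c d \<and> a * d - b * c \<noteq> 0"
    proof cases
      case (1 b c d)
      then show ?thesis by (intro exI[of _ 1] exI[of _ b] exI[of _ c] exI[of _ d]) (simp add: gf4_add_eq_0)
    next
      case (2 c d)
      then show ?thesis by (intro exI[of _ 0] exI[of _ 1] exI[of _ c] exI[of _ d]) simp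
    qed
    then show "mat_of m \<in> Gq_star" by (auto simp: Gq_star_def Mstar_eq_mat_of)
  qed
qed

text \<open>The cubic is the image of the projective line under (x, y) \<mapsto> (x^3, x^2 y, x y^2,
  y^3), and \<open>Mstar\<close> acts on the parameter as t \<mapsto> (a t + b) / (c t + d). The
  nonzero determinant prevents x and y from vanishing together; y = 0 is the parameter at
  infinity.\<close>

lemma vmat_cvec_Mstar:
  fixes a b c d :: "'a::field"
  assumes "a * d - b * c \<noteq> 0"
  shows "\<exists>k t'. k \<noteq> 0 \<and> vmat (cvec t) (Mstar a b c d) = smul k (cvec t')"
proof -
  obtain x y where xy: "x \<noteq> 0 \<or> y \<noteq> 0"
    "vmat (cvec t) (Mstar a b c d) = vec4 (x ^ 3) (x ^ 2 * y) (x * y ^ 2) (y ^ 3)"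
  proof (cases t)
    case None
    have "a \<noteq> 0 \<or> c \<noteq> 0" using assms by auto
    moreover have "vmat (cvec t) (Mstar a b c d) = vec4 (a ^ 3) (a ^ 2 * c) (a * c ^ 2) (c ^ 3)"
      by (simp add: None vec_eq_iff vmat_def sum_idx Mstar_def cvec_def)
    ultimately show ?thesis by (rule that)
  next
    case (Some s)
    have "a * s + b \<noteq> 0 \<or> c * s + d \<noteq> 0"
    proof (rule ccontr)
      assume "\<not> ?thesis"
      then have "a * (c * s + d) - c * (a * s + b) = 0" by simp
      with assms show False by (simp add: algebra_simps)
    qed
    moreover have "vmat (cvec t) (Mstar a b c d) = vec4 ((a * s + b) ^ 3) ((a * s + b) ^ 2 * (c * s + d))
        ((a * s + b) * (c * s + d) ^ 2) ((c * s + d) ^ 3)"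
      by (simp add: Some vec_eq_iff vmat_def sum_idx Mstar_def cvec_def power2_eq_square power3_eq_cube)
        (simp add: algebra_simps)
    ultimately show ?thesis by (rule that)
  qed
  show ?thesis
  proof (cases "y = 0")
    case True
    then show ?thesis using xy
      by (intro exI[of _ "x ^ 3"] exI[of _ None]) (simp add: vec_eq_iff smul_def cvec_def)
  next
    case False
    then show ?thesis using xy
      by (intro exI[of _ "y ^ 3"] exI[of _ "Some (x / y)"])
        (simp add: vec_eq_iff smul_def cvec_def power2_eq_square power3_eq_cube field_simps)
  qed
qed

lemma Gq_star_subset: "Gq_star \<subseteq> (Gq :: gf4 mat set)"
proof
  fix M :: "gf4 mat" assume "M \<in> Gq_star"
  then obtain a b c d where M: "M = Mstar a b c d" "a * d - b * c \<noteq> 0"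
    by (auto simp: Gq_star_def)
  have cube: "(x::gf4) ^ 3 = 1" if "x \<noteq> 0" for x
    using gf4_cube[OF that] by (simp add: power3_eq_cube mult.assoc)
  \<comment> \<open>The cube of the determinant is 1 in F_4, so the adjugate gives the exact
    inverse.\<close>
  have "mmul (Mstar a b c d) (Mstar d (- b) (- c) a) = idm"
    unfolding mmul_Mstar_adjugate cube[OF M(2)] by simp
  moreover have "d * a - (- b) * (- c) \<noteq> 0" using M(2) by (simp add: mult.commute)
  then have "mmul (Mstar d (- b) (- c) a) (Mstar a b c d) = idm"
    using mmul_Mstar_adjugate[of d "- b" "- c" a] by (simp add: cube)
  ultimately have "invertible_mat M" unfolding M(1) invertible_mat_def by blast
  then show "M \<in> Gq" using vmat_cvec_Mstar[OF M(2)] unfolding M(1) by (rule Gq_memI)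
qed

lemma frob_squared: "mmul (mat_of frob) (mat_of frob) = idm"
  by (simp add: fun_eq_iff all_idx mmul_def sum_idx frob_def idm_def)

lemma vmat_frob: "vmat v (mat_of frob) = vec4 (v X0) (v X2) (v X1) (v X3)"
  by (simp add: vec_eq_iff vmat_def sum_idx frob_def)

lemma frob_in_Gq: "mat_of frob \<in> Gq"
proof (rule Gq_memI)
  show "invertible_mat (mat_of frob)" unfolding invertible_mat_def using frob_squared by blast
  fix t :: "gf4 option"
  \<comment> \<open>By x^4 = x and x^6 = x^3 the swapped vector (t^3, t, t^2, 1) is the cubic vector
    with parameter t^2.\<close>
  have "x ^ 2 * x ^ 2 = (x::gf4)" "x ^ 2 * (x ^ 2 * x ^ 2) = (x::gf4) ^ 3" for x
    by (cases x; simp add: power2_eq_square power3_eq_cube)+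
  then have "vmat (cvec t) (mat_of frob) = cvec (map_option (\<lambda>x. x ^ 2) t)"
    by (cases t) (simp_all add: vmat_frob vec_eq_iff cvec_def power2_eq_square power3_eq_cube)
  then show "\<exists>k t'. k \<noteq> 0 \<and> vmat (cvec t) (mat_of frob) = smul k (cvec t')"
    by (intro exI[of _ 1]) auto
qed

section \<open>Elements of \<open>Gq\<close> as permutations of the frame\<close>

fun rcub :: "gf4 option \<Rightarrow> row" where
  "rcub None = Row 1 0 0 0"
| "rcub (Some t) = Row (t * t * t) (t * t) t 1"

lemma row_vec_rcub: "row_vec (rcub t) = cvec t"
  by (cases t) (simp_all add: cvec_def power2_eq_square power3_eq_cube)

text \<open>The matrix sending \<open>cvec t\<close> to \<open>cvec (f t)\<close>, where \<open>p, q, r, m, n\<close> are the values of \<open>f\<close>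
  at \<open>\<infinity>, 0, 1, Ga, Gb\<close>: its middle rows come from \<open>e\<^sub>1 = \<Sum>t. t cvec t\<close> and \<open>e\<^sub>2 = \<Sum>t. t\<^sup>2 cvec t\<close>.\<close>

definition frame_mat :: "gf4 option \<Rightarrow> gf4 option \<Rightarrow> gf4 option \<Rightarrow> gf4 option \<Rightarrow> gf4 option \<Rightarrow> rmat" where
  "frame_mat p q r m n = Rmat (rcub p)
     (radd (rcub r) (radd (rscale Ga (rcub m)) (rscale Gb (rcub n))))
     (radd (rcub r) (radd (rscale Gb (rcub m)) (rscale Ga (rcub n)))) (rcub q)"

fun rmul :: "rmat \<Rightarrow> rmat \<Rightarrow> rmat" where
  "rmul (Rmat p q r s) m = Rmat (rapp m p) (rapp m q) (rapp m r) (rapp m s)"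

lemma mat_of_rmul: "mat_of (rmul m n) = mmul (mat_of m) (mat_of n)"
proof -
  have "mmul M N i = vmat (M i) N" for M N :: "gf4 mat" and i
    by (simp add: mmul_def vmat_def)
  then show ?thesis
    by (cases m) (simp add: fun_eq_iff all_idx vmat_row_vec)
qed

definition ogfs :: "gf4 option list" where "ogfs = None # map Some gfs"

lemma set_ogfs [simp]: "set ogfs = UNIV"
  by (auto simp: ogfs_def UNIV_option_conv)

text \<open>Every permutation of the frame is induced by \<open>PGL(2,4)\<close> or by its product with the Frobenius map.\<close>

lemma frame_mat_cases:
  "\<forall>p\<in>set ogfs. \<forall>q\<in>set (remove1 p ogfs). \<forall>r\<in>set (remove1 q (remove1 p ogfs)).
     \<forall>m\<in>set (remove1 r (remove1 q (remove1 p ogfs))). \<forall>n\<in>set (remove1 m (remove1 r (remove1 q (remove1 p ogfs)))).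
       frame_mat p q r m n \<in> set msts \<or> rmul (frame_mat p q r m n) frob \<in> set msts"
  by code_simp

lemma sum_gf4_option:
  "(\<Sum>t\<in>UNIV. f t) = f None + (f (Some G0) + (f (Some G1) + (f (Some Ga) + f (Some Gb))))"
  by (simp add: UNIV_option_conv UNIV_gf4 sum.reindex)

lemma cvec_gf4:
  "cvec None = vec4 1 0 0 (0::gf4)" "cvec (Some G0) = vec4 0 0 0 1" "cvec (Some G1) = vec4 1 1 1 1"
  "cvec (Some Ga) = vec4 1 Gb Ga 1" "cvec (Some Gb) = vec4 1 Ga Gb 1"
  by (simp_all add: cvec_def power2_eq_square power3_eq_cube zero_gf4_def one_gf4_def)

text \<open>Five vectors spanning a space of dimension four satisfy only one linear relation up to a
  factor; for the frame it is the one with equal coefficients. The two middle coordinates give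
  equality at 1, \<open>Ga\<close> and \<open>Gb\<close>, the outer ones at infinity and 0.\<close>

lemma frame_coefficients_equal:
  fixes k :: "gf4 option \<Rightarrow> gf4"
  assumes "\<And>i. (\<Sum>t\<in>UNIV. k t * cvec t i) = 0"
  shows "k t = k None"
proof -
  let ?k0 = "k (Some G0)" and ?k1 = "k (Some G1)" and ?ka = "k (Some Ga)" and ?kb = "k (Some Gb)"
  have e: "k None + (?k1 + (?ka + ?kb)) = 0" "?k0 + (?k1 + (?ka + ?kb)) = 0"
    "?k1 + (?ka * Gb + ?kb * Ga) = 0" "?k1 + (?ka * Ga + ?kb * Gb) = 0"
    using assms[of X0] assms[of X3] assms[of X1] assms[of X2]
    by (simp_all add: sum_gf4_option cvec_gf4)
  from e(3,4) have ab: "?ka = ?k1" "?kb = ?k1"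
    by (cases ?k1; cases ?ka; cases ?kb; simp add: zero_gf4_def)+
  with e(1,2) have "k None = ?k1" "?k0 = ?k1"
    by (simp_all add: gf4_add_eq_0)
  with ab have "k (Some x) = k None" for x
    by (cases x) simp_all
  then show ?thesis by (cases t) simp_all
qed

lemma sum_cvec: "(\<Sum>t\<in>UNIV. cvec t j) = (0::gf4)"
  by (cases j) (simp_all add: sum_gf4_option cvec_gf4 zero_gf4_def one_gf4_def)

text \<open>Since the frame vectors \<open>cvec t\<close> sum to zero, the factors \<open>k t\<close> by which a collineation of the
  frame scales them all agree.\<close>

lemma Gq_frame:
  fixes M :: "gf4 mat"
  assumes "M \<in> Gq"
  obtains f k where "inj f" "k \<noteq> 0" "\<And>t. vmat (cvec t) M = smul k (cvec (f t))"
proof -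
  have cubic: "pmap M ` range cpt = range cpt"
    using assms by (simp add: Gq_def twisted_cubic_def)
  have "\<exists>f. \<forall>t. pmap M (cpt t) = cpt (f t)"
    using cubic by (intro choice) blast
  then obtain f where f: "pmap M (cpt t) = cpt (f t)" for t by blast
  have inv: "invertible_mat M" using assms by (simp add: Gq_def)
  have inj: "inj f"
  proof (rule injI)
    fix s t assume "f s = f t"
    then have "pmap M (cpt s) = pmap M (cpt t)" by (simp add: f)
    then have "cpt s = cpt t" by (rule injD[OF inj_pmap[OF inv]])
    then show "s = t" by (rule injD[OF inj_cpt])
  qed
  then have bij: "bij f" by (simp add: bij_def finite_UNIV_inj_surj)
  have "\<exists>k. \<forall>t. k t \<noteq> 0 \<and> vmat (cvec t) M = smul (k t) (cvec (f t))"
  proof (intro choice allI)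
    fix t
    show "\<exists>k. k \<noteq> 0 \<and> vmat (cvec t) M = smul k (cvec (f t))"
      using f[of t] unfolding cpt_def pmap_pt pt_eq_iff .
  qed
  then obtain k where k: "k t \<noteq> 0" "vmat (cvec t) M = smul (k t) (cvec (f t))" for t by blast
  \<comment> \<open>Applying M to the relation that the frame vectors sum to zero, and reindexing by
    the permutation f, gives a relation with coefficients \<open>k (inv f t)\<close>.\<close>
  have "k (inv f t) = k (inv f None)" for t
  proof (rule frame_coefficients_equal)
    fix i
    have "(\<Sum>t\<in>UNIV. k (inv f t) * cvec t i) = (\<Sum>t\<in>UNIV. k t * cvec (f t) i)"
      using sum.reindex_bij_betw[OF bij, of "\<lambda>t. k (inv f t) * cvec t i"]
      by (simp add: inv_f_f[OF inj])
    also have "\<dots> = (\<Sum>t\<in>UNIV. vmat (cvec t) M i)"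
      by (simp add: k(2)) (simp add: smul_def)
    also have "\<dots> = (\<Sum>j\<in>UNIV. (\<Sum>t\<in>UNIV. cvec t j) * M j i)"
      unfolding vmat_def by (subst sum.swap) (simp add: sum_distrib_right)
    also have "\<dots> = 0" by (simp add: sum_cvec)
    finally show "(\<Sum>t\<in>UNIV. k (inv f t) * cvec t i) = 0" .
  qed
  note const = this
  define l where "l = k (inv f None)"
  have "k t = l" for t
    using const[of "f t"] by (simp only: inv_f_f[OF inj] l_def)
  with k have "vmat (cvec t) M = smul l (cvec (f t))" and "l \<noteq> 0" for t
    by (simp, metis)
  with inj show ?thesis by (intro that)
qed

text \<open>With (w, x, y, z) a column of a matrix, the four-term sums are its products with the
  cubic vectors at 1, \<open>Ga\<close> and \<open>Gb\<close>. Weighting them by t, respectively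
  t^2, isolates a middle entry, because the sum of t^k over the nonzero t in F_4 is 1 if 3 divides k
  and 0 otherwise.\<close>

lemma gf4_middle_rows:
  fixes w x y z :: gf4
  shows "w + x + y + z + (Ga * (w + Gb * x + Ga * y + z) + Gb * (w + Ga * x + Gb * y + z)) = x"
    and "w + x + y + z + (Gb * (w + Gb * x + Ga * y + z) + Ga * (w + Ga * x + Gb * y + z)) = y"
proof -
  have "\<forall>w\<in>set gfs. \<forall>x\<in>set gfs. \<forall>y\<in>set gfs. \<forall>z\<in>set gfs.
      w + x + y + z + (Ga * (w + Gb * x + Ga * y + z) + Gb * (w + Ga * x + Gb * y + z)) = x \<and>
      w + x + y + z + (Gb * (w + Gb * x + Ga * y + z) + Ga * (w + Ga * x + Gb * y + z)) = y"
    by code_simp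
  then show "w + x + y + z + (Ga * (w + Gb * x + Ga * y + z) + Gb * (w + Ga * x + Gb * y + z)) = x"
    and "w + x + y + z + (Gb * (w + Gb * x + Ga * y + z) + Ga * (w + Ga * x + Gb * y + z)) = y"
    unfolding set_gfs by blast+
qed

lemma Gq_cases:
  fixes M :: "gf4 mat"
  assumes "M \<in> Gq"
  obtains k A where "k \<noteq> 0" "A \<in> Gq_star"
    "M = (\<lambda>i. smul k (A i)) \<or> M = (\<lambda>i. smul k (mmul A (mat_of frob) i))"
proof -
  obtain f k where f: "inj f" "k \<noteq> 0" "\<And>t. vmat (cvec t) M = smul k (cvec (f t))"
    using Gq_frame[OF assms] by blast
  let ?N = "frame_mat (f None) (f (Some G0)) (f (Some G1)) (f (Some Ga)) (f (Some Gb))"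
  have rows: "M X0 = vmat (cvec None) M" "M X3 = vmat (cvec (Some G0)) M"
    "M X1 = vadd (vmat (cvec (Some G1)) M) (vadd (smul Ga (vmat (cvec (Some Ga)) M)) (smul Gb (vmat (cvec (Some Gb)) M)))"
    "M X2 = vadd (vmat (cvec (Some G1)) M) (vadd (smul Gb (vmat (cvec (Some Ga)) M)) (smul Ga (vmat (cvec (Some Gb)) M)))"
    by (simp_all add: fun_eq_iff cvec_gf4 vmat_def sum_idx vadd_def smul_def gf4_middle_rows)
  have M: "M = (\<lambda>i. smul k (mat_of ?N i))"
    unfolding fun_eq_iff[of M] all_idx rows f(3)
    by (simp add: frame_mat_def row_vec_radd row_vec_rscale row_vec_rcub)
      (simp add: fun_eq_iff vadd_def smul_def algebra_simps)
  have "?N \<in> set msts \<or> rmul ?N frob \<in> set msts"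
    using frame_mat_cases inj_eq[OF f(1)] by simp
  then show ?thesis
  proof
    assume "?N \<in> set msts"
    then show ?thesis using that[OF f(2), of "mat_of ?N"] M by (auto simp: Gq_star_eq)
  next
    assume "rmul ?N frob \<in> set msts"
    \<comment> \<open>The swap is an involution, so a second application recovers the frame
      matrix.\<close>
    moreover have "mmul (mat_of (rmul ?N frob)) (mat_of frob) = mat_of ?N"
      by (simp add: mat_of_rmul mmul_assoc frob_squared mmul_idm)
    ultimately show ?thesis
      using that[OF f(2), of "mat_of (rmul ?N frob)"] M by (auto simp: Gq_star_eq)
  qed
qed

section \<open>Orbits of lines computed on codes\<close>

definition ract :: "rmat \<Rightarrow> row \<times> row \<Rightarrow> row \<times> row" where
  "ract m c = rech (rapp m (fst c), rapp m (snd c))"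

definition star_orbit :: "row \<times> row \<Rightarrow> (row \<times> row) list" where
  "star_orbit c = remdups (map (\<lambda>m. ract m c) msts)"

text \<open>An element outside \<open>Gq_star\<close> is, up to a scalar, an element of
  \<open>Gq_star\<close> followed by the swap, so it contributes swap images of the smaller orbit.
  The two halves may coincide, hence the list can contain repetitions.\<close>

definition full_orbit :: "row \<times> row \<Rightarrow> (row \<times> row) list" where
  "full_orbit c = star_orbit c @ map (ract frob) (star_orbit c)"

lemma lmap_line_of:
  assumes "invertible_mat (mat_of m)" "c \<in> set line_codes"
  shows "lmap (mat_of m) (line_of c) = line_of (ract m c)"
proof -
  have "independent (row_vec (rapp m (fst c))) (row_vec (rapp m (snd c)))"
    using independent_vmat[OF assms(1) independent_line_code[OF assms(2)]]
    by (simp add: vmat_row_vec)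
  then have "line_of (ract m c) = line_of (rapp m (fst c), rapp m (snd c))"
    unfolding ract_def by (intro line_of_rech) simp
  then show ?thesis
    by (simp add: line_of_def lmap_line_through[OF assms(1)] vmat_row_vec)
qed

lemma ract_in_line_codes: "ract m c \<in> set line_codes"
  by (simp add: ract_def rech_in_line_codes)

lemma star_orbit_subset: "set (star_orbit c) \<subseteq> set line_codes"
  by (auto simp: star_orbit_def ract_in_line_codes)

lemma full_orbit_subset: "set (full_orbit c) \<subseteq> set line_codes"
  using star_orbit_subset by (auto simp: full_orbit_def ract_in_line_codes)

lemma line_orbit_Gq_star:
  assumes "c \<in> set line_codes"
  shows "line_orbit Gq_star (line_of c) = line_of ` set (star_orbit c)"
proof -
  have "lmap (mat_of m) (line_of c) = line_of (ract m c)" if "m \<in> set msts" for m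
    using that Gq_star_subset by (intro lmap_line_of assms) (auto simp: Gq_star_eq Gq_def)
  then show ?thesis
    by (simp add: line_orbit_def Gq_star_eq star_orbit_def image_image)
qed

text \<open>Proportional matrices define the same projectivity; this removes the scalar k left over
  by \<open>Gq_cases\<close>.\<close>

lemma lmap_scaled:
  assumes "k \<noteq> 0"
  shows "lmap (\<lambda>i. smul k (A i)) (line_of c) = lmap A (line_of c)"
proof -
  have "vmat x (\<lambda>i. smul k (A i)) = smul k (vmat x A)" for x
    by (simp add: fun_eq_iff vmat_def smul_def sum_distrib_left algebra_simps)
  then have "pmap (\<lambda>i. smul k (A i)) (pt x) = pmap A (pt x)" for x
    by (simp add: pmap_pt pt_smul[OF assms])
  then show ?thesis
    unfolding lmap_def line_of_def line_through_alt by (intro image_cong) auto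
qed

lemma line_orbit_Gq:
  assumes "c \<in> set line_codes"
  shows "line_orbit Gq (line_of c) = line_of ` set (full_orbit c)"
proof -
  let ?F = "mat_of frob"
  have inv: "invertible_mat ?F" using frob_in_Gq by (simp add: Gq_def)
  have "line_orbit Gq (line_of c) = line_orbit Gq_star (line_of c) \<union> lmap ?F ` line_orbit Gq_star (line_of c)"
    (is "_ = ?R")
  proof
    show "line_orbit Gq (line_of c) \<subseteq> ?R"
    proof
      fix l assume "l \<in> line_orbit Gq (line_of c)"
      then obtain M where M: "M \<in> Gq" "l = lmap M (line_of c)" by (auto simp: line_orbit_def)
      obtain k A where A: "k \<noteq> 0" "A \<in> Gq_star"
        "M = (\<lambda>i. smul k (A i)) \<or> M = (\<lambda>i. smul k (mmul A ?F i))"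
        using Gq_cases[OF M(1)] by blast
      then have "l = lmap A (line_of c) \<or> l = lmap ?F (lmap A (line_of c))"
        by (auto simp: M(2) lmap_scaled lmap_mmul)
      with A(2) show "l \<in> ?R" by (auto simp: line_orbit_def)
    qed
    show "?R \<subseteq> line_orbit Gq (line_of c)"
      using Gq_star_subset Gq_mmul[OF _ frob_in_Gq]
      by (fastforce simp: line_orbit_def simp flip: lmap_mmul)
  qed
  also have "\<dots> = line_of ` set (full_orbit c)"
  proof -
    have "lmap ?F ` line_of ` set (star_orbit c) = line_of ` ract frob ` set (star_orbit c)"
      unfolding image_image using star_orbit_subset[of c]
      by (intro image_cong refl lmap_line_of[OF inv]) blast
    then show ?thesis
      by (simp only: line_orbit_Gq_star[OF assms] full_orbit_def set_append set_map image_Un)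
  qed
  finally show ?thesis .
qed

section \<open>The line types\<close>

fun rosc :: "gf4 option \<Rightarrow> row" where
  "rosc None = Row 0 0 0 1"
| "rosc (Some t) = Row 1 t (t * t) (t * t * t)"

lemma row_vec_rosc: "row_vec (rosc t) = osc_coef t"
  by (cases t) (simp_all add: osc_coef_def gf4_three power2_eq_square power3_eq_cube)

definition rspan :: "row \<times> row \<Rightarrow> row list" where
  "rspan c = map (\<lambda>(a, b). radd (rscale a (fst c)) (rscale b (snd c))) (List.product gfs gfs)"

definition cubic_points :: "row \<times> row \<Rightarrow> gf4 option list" where
  "cubic_points c = filter (\<lambda>t. rcub t \<in> set (rspan c)) ogfs"

definition osc_planes :: "row \<times> row \<Rightarrow> gf4 option list" where
  "osc_planes c = filter (\<lambda>t. rdot (rosc t) (fst c) = 0 \<and> rdot (rosc t) (snd c) = 0) ogfs"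

lemma cvec_nonzero: "cvec t \<noteq> zvec"
  by (cases t) (simp_all add: vec_eq_iff cvec_def zvec_def)

lemma cpt_in_line_of_iff: "cpt t \<in> line_of c \<longleftrightarrow> t \<in> set (cubic_points c)"
proof -
  have "row_vec ` set (rspan c) = {lincomb (row_vec (fst c)) (row_vec (snd c)) a b | a b. True}"
    by (force simp: rspan_def row_vec_radd row_vec_rscale lincomb_def image_iff)
  then have "rcub t \<in> set (rspan c) \<longleftrightarrow> (\<exists>a b. cvec t = lincomb (row_vec (fst c)) (row_vec (snd c)) a b)"
    unfolding row_vec_rcub[symmetric]
    by (smt (verit, best) image_iff mem_Collect_eq row_vec_inject)
  then show ?thesis
    by (simp add: cpt_def line_of_def pt_in_line_iff cvec_nonzero cubic_points_def)
qed

lemma card_cubic_line_of: "card (line_of c \<inter> twisted_cubic) = length (cubic_points c)"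
proof -
  have "line_of c \<inter> twisted_cubic = cpt ` set (cubic_points c)"
    by (auto simp: twisted_cubic_def simp flip: cpt_in_line_of_iff)
  moreover have "distinct (cubic_points c)"
    unfolding cubic_points_def by (intro distinct_filter) (simp add: ogfs_def gfs_def)
  ultimately show ?thesis
    by (simp add: card_image[OF inj_on_subset[OF inj_cpt subset_UNIV]] distinct_card)
qed

lemma cubic_line_of_empty_iff: "line_of c \<inter> twisted_cubic = {} \<longleftrightarrow> cubic_points c = []"
  using card_cubic_line_of[of c] by (metis card_0_eq finite_Int finite twisted_cubic_def finite_imageI length_0_conv)

lemma dot_smul: "dot c (smul k x) = k * dot c x"
  by (simp add: dot_def smul_def sum_distrib_left algebra_simps)

lemma dot_lincomb: "dot c (lincomb u v a b) = a * dot c u + b * dot c v"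
  by (simp add: dot_def sum_idx lincomb_apply algebra_simps)

lemma pt_in_plane_iff: "pt x \<in> plane c \<longleftrightarrow> x \<noteq> zvec \<and> dot c x = 0"
  unfolding plane_def by (rule pt_set_mem_iff) (simp add: dot_smul)

lemma line_through_subset_plane_iff:
  assumes "independent u v"
  shows "line_through u v \<subseteq> plane c \<longleftrightarrow> dot c u = 0 \<and> dot c v = 0"
proof
  assume s: "line_through u v \<subseteq> plane c"
  have "pt u \<in> line_through u v" "pt v \<in> line_through u v"
    using assms unfolding pt_in_line_iff independent_iff by (metis lincomb_unit)+
  with s show "dot c u = 0 \<and> dot c v = 0" by (metis subsetD pt_in_plane_iff)
qed (auto simp: line_through_alt pt_in_plane_iff dot_lincomb)

lemma line_of_subset_osc_iff:
  assumes "c \<in> set line_codes"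
  shows "line_of c \<subseteq> osc t \<longleftrightarrow> t \<in> set (osc_planes c)"
  unfolding line_of_def osc_def line_through_subset_plane_iff[OF independent_line_code[OF assms]]
  by (simp add: osc_planes_def dot_row_vec flip: row_vec_rosc)

lemma plane_Int_plane: "plane c \<inter> plane d = {pt x | x. x \<noteq> zvec \<and> dot c x = 0 \<and> dot d x = 0}"
proof
  show "plane c \<inter> plane d \<subseteq> {pt x | x. x \<noteq> zvec \<and> dot c x = 0 \<and> dot d x = 0}"
  proof
    fix p assume p: "p \<in> plane c \<inter> plane d"
    then obtain x where x: "p = pt x" "x \<noteq> zvec" "dot c x = 0" by (auto simp: plane_def)
    moreover have "dot d x = 0" using p by (simp add: x(1) pt_in_plane_iff)
    ultimately show "p \<in> {pt x | x. x \<noteq> zvec \<and> dot c x = 0 \<and> dot d x = 0}" by blast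
  qed
qed (auto simp: pt_in_plane_iff)

text \<open>Lines of the largest Schubert cell are graphs of linear maps from (x2, x3) to (x0, x1).
  All imaginary chords and axes, and the real axes with two finite parameters, have this
  form.\<close>

lemma line_of_graph:
  assumes "\<And>x. P x \<longleftrightarrow> x X0 = x X2 * a + x X3 * b \<and> x X1 = x X2 * c + x X3 * d"
  shows "{pt x | x. x \<noteq> zvec \<and> P x} = line_of (Row a c 1 0, Row b d 0 1)"
proof -
  have "P x \<longleftrightarrow> (\<exists>y z. x = lincomb (vec4 a c 1 0) (vec4 b d 0 1) y z)" for x
    by (auto simp: assms vec_eq_iff lincomb_apply)
  then show ?thesis by (simp add: line_of_def line_through_alt)
qed

text \<open>The axis and the chord belonging to the two roots of \<open>t\<^sup>2 + T t + N\<close>.\<close>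

definition axis_code :: "gf4 \<Rightarrow> gf4 \<Rightarrow> row \<times> row" where
  "axis_code T N = (Row N T 1 0, Row (T * N) (T * T + N) 0 1)"

definition chord_code :: "gf4 \<Rightarrow> gf4 \<Rightarrow> row \<times> row" where
  "chord_code T N = (Row (T * T + N) T 1 0, Row (T * N) N 0 1)"

section \<open>Conjugate pairs in F_16 and the imaginary lines\<close>

lemma emb_add: "emb (a + b) = emb a + emb b"
  by (simp add: emb_def)

lemma emb_mult: "emb (a * b) = emb a * emb b"
  by (simp add: emb_def)

lemma emb_zero: "emb 0 = 0"
  by (simp add: emb_def zero_gf16_def)

lemma emb_inject: "emb a = emb b \<longleftrightarrow> a = b"
  by (simp add: emb_def)

lemma gf16_diff [simp]: "x - y = x + y" for x y :: gf16
  by (simp add: minus_gf16_def)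

lemma gf16_uminus [simp]: "- x = x" for x :: gf16
  by (simp add: uminus_gf16_def)

lemma gf16_add_self [simp]: "x + x = 0" for x :: gf16
  by (cases x) (simp add: zero_gf16_def)

lemma gf16_add_left_cancel [simp]: "x + (x + y) = y" for x y :: gf16
  by (simp flip: add.assoc)

lemma gf16_three: "3 = (1::gf16)"
proof -
  have "(2::gf16) = 0"
    using gf16_add_self[of 1] unfolding one_add_one .
  moreover have "(3::gf16) = 2 + 1" by simp
  ultimately show ?thesis by (simp only: add_0_left)
qed

text \<open>Relative trace over F_4. The generator is a root of X^2 + X + \<open>Ga\<close>, so it
  has trace 1 and norm \<open>Ga\<close>; since 2 p = 0, the trace of p + q theta is q.\<close>

definition trace_of :: "gf16 \<Rightarrow> gf4" where
  "trace_of \<alpha> = (case \<alpha> of F16 p q \<Rightarrow> q)"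

definition norm_of :: "gf16 \<Rightarrow> gf4" where
  "norm_of \<alpha> = (case \<alpha> of F16 p q \<Rightarrow> p * p + p * q + Ga * (q * q))"

lemma gf16_conj:
  shows "\<alpha> + \<alpha> ^ 4 = emb (trace_of \<alpha>)" and "\<alpha> * \<alpha> ^ 4 = emb (norm_of \<alpha>)"
proof -
  have "\<forall>p\<in>set gfs. \<forall>q\<in>set gfs.
      F16 p q + F16 p q * F16 p q * F16 p q * F16 p q = emb (trace_of (F16 p q)) \<and>
      F16 p q * (F16 p q * F16 p q * F16 p q * F16 p q) = emb (norm_of (F16 p q))"
    by code_simp
  moreover obtain p q where "\<alpha> = F16 p q" by (cases \<alpha>)
  ultimately show "\<alpha> + \<alpha> ^ 4 = emb (trace_of \<alpha>)" and "\<alpha> * \<alpha> ^ 4 = emb (norm_of \<alpha>)"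
    unfolding set_gfs power4_eq_xxxx by blast+
qed

lemma gf16_square: "\<alpha> * \<alpha> = emb (trace_of \<alpha>) * \<alpha> + emb (norm_of \<alpha>)"
proof -
  have "emb (trace_of \<alpha>) * \<alpha> + emb (norm_of \<alpha>) = (\<alpha> + \<alpha> ^ 4) * \<alpha> + \<alpha> * \<alpha> ^ 4"
    by (simp only: gf16_conj)
  also have "\<dots> = \<alpha> * \<alpha> + (\<alpha> * \<alpha> ^ 4 + \<alpha> * \<alpha> ^ 4)"
    by (simp only: algebra_simps)
  finally show ?thesis by simp
qed

lemma gf16_affine_eq_zero_iff:
  assumes "\<alpha> \<notin> range emb"
  shows "emb x + emb y * \<alpha> = 0 \<longleftrightarrow> x = 0 \<and> y = 0"
proof -
  obtain p q where a: "\<alpha> = F16 p q" by (cases \<alpha>)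
  with assms have "q \<noteq> 0" by (auto simp: emb_def)
  then show ?thesis by (auto simp: a emb_def zero_gf16_def)
qed

lemma gf16_conj_notin: "\<alpha> \<notin> range emb \<Longrightarrow> \<alpha> ^ 4 \<notin> range emb"
proof
  assume a: "\<alpha> \<notin> range emb" and "\<alpha> ^ 4 \<in> range emb"
  then obtain x where "\<alpha> ^ 4 = emb x" by auto
  then have "\<alpha> = emb (trace_of \<alpha> + x)"
    by (simp add: emb_add add.assoc flip: gf16_conj(1))
  with a show False by auto
qed

text \<open>The minimal polynomial reduces the powers of \<alpha>: \<alpha>^3 = (T^2 + N) \<alpha> +
  T N. As 1 and \<alpha> are independent over F_4, one equation over F_16 splits into two over
  F_4.\<close>

lemma osc_dot_eq_zero_iff:
  assumes "\<alpha> \<notin> range emb" "\<alpha> * \<alpha> = emb T * \<alpha> + emb N"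
  shows "dot (osc_coef (Some \<alpha>)) (emb \<circ> x) = 0 \<longleftrightarrow>
    x X0 = x X2 * N + x X3 * (T * N) \<and> x X1 = x X2 * T + x X3 * (T * T + N)"
proof -
  have c: "\<alpha> * (\<alpha> * \<alpha>) = emb (T * T + N) * \<alpha> + emb (T * N)"
  proof -
    have "\<alpha> * (\<alpha> * \<alpha>) = \<alpha> * (emb T * \<alpha> + emb N)"
      by (simp only: assms(2))
    also have "\<dots> = emb T * (\<alpha> * \<alpha>) + emb N * \<alpha>"
      by (simp only: algebra_simps)
    also have "\<dots> = emb T * (emb T * \<alpha> + emb N) + emb N * \<alpha>"
      by (simp only: assms(2))
    finally show ?thesis by (simp add: emb_add emb_mult algebra_simps)
  qed
  have "dot (osc_coef (Some \<alpha>)) (emb \<circ> x) =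
      emb (x X0) + \<alpha> * emb (x X1) + \<alpha> * \<alpha> * emb (x X2) + \<alpha> * (\<alpha> * \<alpha>) * emb (x X3)"
    by (simp add: dot_def sum_idx osc_coef_def gf16_three power2_eq_square power3_eq_cube mult.assoc)
  also have "\<dots> = emb (x X0 + (x X2 * N + x X3 * (T * N))) + emb (x X1 + (x X2 * T + x X3 * (T * T + N))) * \<alpha>"
    unfolding c unfolding assms(2) by (simp add: emb_add emb_mult algebra_simps)
  finally show ?thesis
    by (simp only: gf16_affine_eq_zero_iff[OF assms(1)] gf4_add_eq_0)
qed

text \<open>Conjugate elements have the same trace and norm, so both osculating planes cut out the
  same two equations over F_4.\<close>

lemma ia_line_eq:
  assumes "\<alpha> \<notin> range emb"
  shows "ia_line \<alpha> = line_of (axis_code (trace_of \<alpha>) (norm_of \<alpha>))"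
  unfolding ia_line_def axis_code_def
proof (rule line_of_graph)
  fix x
  have sq: "\<alpha> ^ 4 * \<alpha> ^ 4 = emb (trace_of \<alpha>) * \<alpha> ^ 4 + emb (norm_of \<alpha>)"
  proof -
    have "emb (trace_of \<alpha>) * \<alpha> ^ 4 + emb (norm_of \<alpha>) = (\<alpha> + \<alpha> ^ 4) * \<alpha> ^ 4 + \<alpha> * \<alpha> ^ 4"
      by (simp only: gf16_conj)
    also have "\<dots> = \<alpha> ^ 4 * \<alpha> ^ 4 + (\<alpha> * \<alpha> ^ 4 + \<alpha> * \<alpha> ^ 4)"
      by (simp only: distrib_right add.commute add.left_commute)
    finally show ?thesis by simp
  qed
  show "dot (osc_coef (Some \<alpha>)) (emb \<circ> x) = 0 \<and> dot (osc_coef (Some (\<alpha> ^ 4))) (emb \<circ> x) = 0 \<longleftrightarrow>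
    x X0 = x X2 * norm_of \<alpha> + x X3 * (trace_of \<alpha> * norm_of \<alpha>) \<and>
    x X1 = x X2 * trace_of \<alpha> + x X3 * (trace_of \<alpha> * trace_of \<alpha> + norm_of \<alpha>)"
    unfolding osc_dot_eq_zero_iff[OF assms gf16_square]
      osc_dot_eq_zero_iff[OF gf16_conj_notin[OF assms] sq] by blast
qed

text \<open>Put s_n = a \<alpha>^n + b \<beta>^n with \<beta> the conjugate of \<alpha>. Then (x0,
  x1, x2, x3) = (s_3, s_2, s_1, s_0), and s_(n+2) = T s_(n+1) + N s_n expresses x0 and x1 through x2
  and x3. Conversely x2 and x3 determine a and b, because \<alpha> and \<beta> differ.\<close>

lemma ic_line_eq:
  assumes "\<alpha> \<notin> range emb"
  shows "ic_line \<alpha> = line_of (chord_code (trace_of \<alpha>) (norm_of \<alpha>))"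
  unfolding ic_line_def chord_code_def
proof (rule line_of_graph)
  fix x :: "gf4 vec"
  define \<beta> where "\<beta> = \<alpha> ^ 4"
  let ?T = "trace_of \<alpha>" and ?N = "norm_of \<alpha>"
  have T: "emb ?T = \<alpha> + \<beta>" and N: "emb ?N = \<alpha> * \<beta>"
    unfolding \<beta>_def by (simp_all only: gf16_conj)
  have "\<alpha> + \<beta> \<noteq> 0"
  proof -
    obtain p q where "\<alpha> = F16 p q" by (cases \<alpha>)
    with assms have "?T \<noteq> 0" by (auto simp: emb_def trace_of_def)
    then show ?thesis by (simp only: T[symmetric] emb_zero[symmetric] emb_inject not_False_eq_True)
  qed
  have solve: "\<exists>a b. a + b = y \<and> a * \<alpha> + b * \<beta> = z" for y z
  proof (intro exI conjI)
    let ?D = "\<alpha> + \<beta>"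
    have "(z + y * \<beta>) / ?D + (z + y * \<alpha>) / ?D = y * ?D / ?D"
      by (simp add: algebra_simps flip: add_divide_distrib)
    then show "(z + y * \<beta>) / ?D + (z + y * \<alpha>) / ?D = y" using \<open>?D \<noteq> 0\<close> by simp
    have "(z + y * \<beta>) / ?D * \<alpha> + (z + y * \<alpha>) / ?D * \<beta> = z * ?D / ?D"
      by (simp add: algebra_simps flip: add_divide_distrib)
    then show "(z + y * \<beta>) / ?D * \<alpha> + (z + y * \<alpha>) / ?D * \<beta> = z" using \<open>?D \<noteq> 0\<close> by simp
  qed
  show "(\<exists>a b. emb \<circ> x = vadd (smul a (cvec (Some \<alpha>))) (smul b (cvec (Some (\<alpha> ^ 4))))) \<longleftrightarrow>
    x X0 = x X2 * (?T * ?T + ?N) + x X3 * (?T * ?N) \<and> x X1 = x X2 * ?T + x X3 * ?N" (is "?L \<longleftrightarrow> ?R")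
  proof -
    have R: "?R \<longleftrightarrow> emb (x X0) = emb (x X2) * ((\<alpha> + \<beta>) * (\<alpha> + \<beta>) + \<alpha> * \<beta>) + emb (x X3) * ((\<alpha> + \<beta>) * (\<alpha> * \<beta>)) \<and>
      emb (x X1) = emb (x X2) * (\<alpha> + \<beta>) + emb (x X3) * (\<alpha> * \<beta>)"
      by (simp only: T[symmetric] N[symmetric] emb_add[symmetric] emb_mult[symmetric] emb_inject)
    have "?L \<longleftrightarrow> (\<exists>a b. emb (x X0) = a * (\<alpha> * \<alpha> * \<alpha>) + b * (\<beta> * \<beta> * \<beta>) \<and> emb (x X1) = a * (\<alpha> * \<alpha>) + b * (\<beta> * \<beta>) \<and>
        emb (x X2) = a * \<alpha> + b * \<beta> \<and> emb (x X3) = a + b)"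
      by (simp add: vec_eq_iff vadd_def smul_def cvec_def \<beta>_def power2_eq_square power3_eq_cube)
    also have "\<dots> \<longleftrightarrow> ?R"
      unfolding R
    proof
      assume X: "emb (x X0) = emb (x X2) * ((\<alpha> + \<beta>) * (\<alpha> + \<beta>) + \<alpha> * \<beta>) + emb (x X3) * ((\<alpha> + \<beta>) * (\<alpha> * \<beta>)) \<and>
        emb (x X1) = emb (x X2) * (\<alpha> + \<beta>) + emb (x X3) * (\<alpha> * \<beta>)"
      obtain a b where ab: "emb (x X3) = a + b" "emb (x X2) = a * \<alpha> + b * \<beta>"
        using solve[of "emb (x X3)" "emb (x X2)"] by metis
      show "\<exists>a b. emb (x X0) = a * (\<alpha> * \<alpha> * \<alpha>) + b * (\<beta> * \<beta> * \<beta>) \<and> emb (x X1) = a * (\<alpha> * \<alpha>) + b * (\<beta> * \<beta>) \<and>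
        emb (x X2) = a * \<alpha> + b * \<beta> \<and> emb (x X3) = a + b"
        by (intro exI[of _ a] exI[of _ b]) (simp add: X ab algebra_simps)
    qed (auto simp: algebra_simps)
    finally show ?thesis .
  qed
qed

lemma line_ofI:
  assumes "\<And>x. P x \<longleftrightarrow> (\<exists>y z. x = lincomb (row_vec r) (row_vec s) y z)"
  shows "{pt x | x. x \<noteq> zvec \<and> P x} = line_of (r, s)"
  by (simp add: line_of_def line_through_alt assms)

lemma ell1_eq: "ell1 \<xi> = line_of (Row 0 1 0 0, Row \<xi> 0 0 1)"
  unfolding ell1_def plane_Int_plane
  by (rule line_ofI) (auto simp: vec_eq_iff lincomb_apply dot_def sum_idx gf4_add_eq_0 mult.commute)

lemma ell2_eq: "ell2 \<xi> = line_of (Row 0 0 1 0, Row \<xi> 0 0 1)"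
  unfolding ell2_def plane_Int_plane
  by (rule line_ofI) (auto simp: vec_eq_iff lincomb_apply dot_def sum_idx gf4_add_eq_0 mult.commute)

lemma primitive_elem_cases:
  assumes "primitive_elem \<xi>"
  shows "\<xi> = Ga \<or> \<xi> = Gb"
proof -
  \<comment> \<open>Looking at \<open>Ga\<close> alone is enough: no power of 0 or 1 equals
    it.\<close>
  obtain k :: nat where "Ga = \<xi> ^ k"
    using assms by (auto simp: primitive_elem_def zero_gf4_def)
  then have "\<xi> \<noteq> 0" "\<xi> \<noteq> 1"
    by (auto simp: zero_gf4_def one_gf4_def power_0_left split: if_splits simp flip: zero_gf4_def one_gf4_def)
      (simp_all add: zero_gf4_def one_gf4_def)
  then show ?thesis by (cases \<xi>) (simp_all add: zero_gf4_def one_gf4_def)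
qed

text \<open>The same reduction modulo X^2 + T X + N as for imaginary axes, now with a quadratic that
  splits: T = a + b and N = a b. The two planes become u + t v = 0 at two different values of t,
  which forces u = v = 0.\<close>

lemma RA_affine:
  assumes "a \<noteq> b"
  shows "osc (Some a) \<inter> osc (Some b) = line_of (axis_code (a + b) (a * b))"
  unfolding osc_def plane_Int_plane axis_code_def
proof (rule line_of_graph)
  fix x
  let ?u = "x X0 + (x X2 * (a * b) + x X3 * ((a + b) * (a * b)))"
  let ?v = "x X1 + (x X2 * (a + b) + x X3 * ((a + b) * (a + b) + a * b))"
  have d: "dot (osc_coef (Some a)) x = ?u + a * ?v" "dot (osc_coef (Some b)) x = ?u + b * ?v"
    by (simp_all add: dot_def sum_idx osc_coef_def gf4_three power2_eq_square power3_eq_cube algebra_simps)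
  have "?u + a * ?v = 0 \<and> ?u + b * ?v = 0 \<longleftrightarrow> ?u = 0 \<and> ?v = 0"
    using assms by (auto simp: gf4_add_eq_0)
  then show "dot (osc_coef (Some a)) x = 0 \<and> dot (osc_coef (Some b)) x = 0 \<longleftrightarrow>
      x X0 = x X2 * (a * b) + x X3 * ((a + b) * (a * b)) \<and>
      x X1 = x X2 * (a + b) + x X3 * ((a + b) * (a + b) + a * b)"
    unfolding d by (simp only: gf4_add_eq_0)
qed

lemma RA_infinity: "osc None \<inter> osc (Some a) = line_of (Row a 1 0 0, Row (a * a) 0 1 0)"
  unfolding osc_def plane_Int_plane
  by (rule line_ofI)
    (auto simp: vec_eq_iff lincomb_apply dot_def sum_idx osc_coef_def gf4_three power2_eq_square
      gf4_add_eq_0 mult.commute add.assoc)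

definition RA_codes :: "(row \<times> row) list" where
  "RA_codes = concat (map (\<lambda>a. map (\<lambda>b. axis_code (a + b) (a * b)) (remove1 a gfs)) gfs)
     @ map (\<lambda>a. (Row a 1 0 0, Row (a * a) 0 1 0)) gfs"

lemma distinct_gfs: "distinct gfs"
  by (simp add: gfs_def)

lemma RA_lines_eq: "RA_lines = line_of ` set RA_codes"
proof -
  have codes: "set RA_codes = {axis_code (a + b) (a * b) | a b. a \<noteq> b} \<union> {(Row a 1 0 0, Row (a * a) 0 1 0) | a. True}"
    by (auto simp: RA_codes_def set_remove1_eq[OF distinct_gfs])
  show ?thesis
  proof
    show "RA_lines \<subseteq> line_of ` set RA_codes"
    proof
      fix l assume "l \<in> RA_lines"
      then obtain s t where l: "l = osc s \<inter> osc t" "s \<noteq> t" by (auto simp: RA_lines_def)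
      consider a b where "s = Some a" "t = Some b" "a \<noteq> b" | a where "s = None" "t = Some a" | a where "t = None" "s = Some a"
        using l(2) by (cases s; cases t) auto
      then show "l \<in> line_of ` set RA_codes"
      proof cases
        case 1 then show ?thesis unfolding l codes by (auto simp: RA_affine)
      next
        case 2 then show ?thesis unfolding l codes by (auto simp: RA_infinity)
      next
        case 3 then show ?thesis unfolding l codes by (auto simp: RA_infinity Int_commute[of _ "osc None"])
      qed
    qed
    show "line_of ` set RA_codes \<subseteq> RA_lines"
      unfolding codes RA_lines_def by (auto simp flip: RA_affine RA_infinity) blast+
  qed
qed

text \<open>Since 2 s = 0, the tangent at s is x0 = s^2 x2, x1 = s^2 x3. The five tangents are thus
  a regulus of the quadric x0 x3 = x1 x2.\<close>

definition Tr_codes :: "(row \<times> row) list" where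
  "Tr_codes = (Row 1 0 0 0, Row 0 1 0 0) # map (\<lambda>s. (Row (s * s) 0 1 0, Row 0 (s * s) 0 1)) gfs"

lemma Tr_lines_eq: "Tr_lines = line_of ` set Tr_codes"
proof -
  have "tangent (Some s) = line_of (Row (s * s) 0 1 0, Row 0 (s * s) 0 1)" for s
  proof -
    have "cvec (Some s) = lincomb (row_vec (Row (s * s) 0 1 0)) (row_vec (Row 0 (s * s) 0 1)) s 1"
      "vec4 (3 * s ^ 2) (2 * s) 1 0 = lincomb (row_vec (Row (s * s) 0 1 0)) (row_vec (Row 0 (s * s) 0 1)) 1 0"
      by (simp_all add: vec_eq_iff lincomb_apply cvec_def gf4_two gf4_three power2_eq_square power3_eq_cube)
    then show ?thesis
      unfolding tangent_def option.case line_of_def fst_conv snd_conv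
      by (simp only:) (rule line_through_lincomb, simp)
  qed
  moreover have "tangent None = line_of (Row 1 0 0 0, Row 0 1 0 0)"
    by (simp add: tangent_def line_of_def)
  ultimately show ?thesis
    by (simp add: Tr_lines_def Tr_codes_def UNIV_option_conv image_image)
qed

text \<open>An element p + q theta lies outside F_4 exactly when q is nonzero. Conjugates share
  trace and norm, so each of the six pairs occurs twice.\<close>

definition imaginary_params :: "(gf4 \<times> gf4) list" where
  "imaginary_params = concat (map (\<lambda>p. map (\<lambda>q. (q, p * p + p * q + Ga * (q * q))) [G1, Ga, Gb]) gfs)"

lemma imaginary_params:
  "set imaginary_params = {(trace_of \<alpha>, norm_of \<alpha>) | \<alpha>. \<alpha> \<notin> range emb}"
proof -
  have "{(trace_of \<alpha>, norm_of \<alpha>) | \<alpha>. \<alpha> \<notin> range emb} = {(q, p * p + p * q + Ga * (q * q)) | p q. q \<noteq> 0}"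
  proof (intro equalityI subsetI)
    fix z assume "z \<in> {(trace_of \<alpha>, norm_of \<alpha>) | \<alpha>. \<alpha> \<notin> range emb}"
    then obtain \<alpha> where a: "z = (trace_of \<alpha>, norm_of \<alpha>)" "\<alpha> \<notin> range emb" by auto
    obtain p q where pq: "\<alpha> = F16 p q" by (cases \<alpha>)
    with a(2) have "q \<noteq> 0" by (auto simp: emb_def)
    then show "z \<in> {(q, p * p + p * q + Ga * (q * q)) | p q. q \<noteq> 0}"
      unfolding a(1) pq by (auto simp: trace_of_def norm_of_def)
  next
    fix z assume "z \<in> {(q, p * p + p * q + Ga * (q * q)) | p q. q \<noteq> 0}"
    then obtain p q where z: "z = (q, p * p + p * q + Ga * (q * q))" "q \<noteq> 0" by auto
    have "F16 p q \<notin> range emb" using z(2) by (auto simp: emb_def)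
    then show "z \<in> {(trace_of \<alpha>, norm_of \<alpha>) | \<alpha>. \<alpha> \<notin> range emb}"
      unfolding z(1) by (intro CollectI exI[of _ "F16 p q"]) (simp add: trace_of_def norm_of_def)
  qed
  also have "\<dots> = set imaginary_params"
  proof -
    have "{q. q \<noteq> (0::gf4)} = {G1, Ga, Gb}"
      by (auto simp: zero_gf4_def) (metis gf4.exhaust)
    then have "q \<noteq> 0 \<longleftrightarrow> q \<in> {G1, Ga, Gb}" for q by blast
    then show ?thesis unfolding imaginary_params_def by auto
  qed
  finally show ?thesis by simp
qed

definition IC_codes :: "(row \<times> row) list" where
  "IC_codes = map (\<lambda>(T, N). chord_code T N) imaginary_params"

definition IA_codes :: "(row \<times> row) list" where
  "IA_codes = map (\<lambda>(T, N). axis_code T N) imaginary_params"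

lemma IC_lines_eq: "IC_lines = line_of ` set IC_codes"
  unfolding IC_lines_def IC_codes_def set_map imaginary_params setcompr_eq_image image_image
  by (rule image_cong) (simp_all add: ic_line_eq)

lemma IA_lines_eq: "IA_lines = line_of ` set IA_codes"
  unfolding IA_lines_def IA_codes_def set_map imaginary_params setcompr_eq_image image_image
  by (rule image_cong) (simp_all add: ia_line_eq)

section \<open>Line types as conditions on codes\<close>

lemma Collect_line_of:
  assumes "\<And>l. P l \<Longrightarrow> l \<in> lines" and "\<And>c. c \<in> set line_codes \<Longrightarrow> P (line_of c) \<longleftrightarrow> Q c"
  shows "{l. P l} = line_of ` {c \<in> set line_codes. Q c}"
proof (intro equalityI subsetI)
  fix l assume l: "l \<in> {l. P l}"
  then obtain c where "c \<in> set line_codes" "l = line_of c"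
    using assms(1) unfolding lines_eq by blast
  with l assms(2) show "l \<in> line_of ` {c \<in> set line_codes. Q c}" by blast
qed (use assms(2) in blast)

lemma RC_lines_eq: "RC_lines = line_of ` {c \<in> set line_codes. 2 \<le> length (cubic_points c)}"
proof -
  have "(\<exists>s t. s \<noteq> t \<and> cpt s \<in> line_of c \<and> cpt t \<in> line_of c) \<longleftrightarrow> 2 \<le> length (cubic_points c)" for c
  proof -
    have "distinct (cubic_points c)"
      by (simp add: cubic_points_def ogfs_def gfs_def)
    then have "\<not> 2 \<le> length (cubic_points c) \<longleftrightarrow> card (set (cubic_points c)) \<le> Suc 0"
      by (auto simp: distinct_card)
    then show ?thesis by (auto simp: card_le_Suc0_iff_eq cpt_in_line_of_iff)
  qed
  then show ?thesis
    unfolding RC_lines_def by (intro Collect_line_of) (auto simp: lines_eq)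
qed

lemma unisecant_line_of:
  assumes "c \<in> set line_codes"
  shows "unisecant (line_of c) \<longleftrightarrow> length (cubic_points c) = 1"
  using assms by (simp add: unisecant_def lines_eq card_cubic_line_of)

lemma external_line_of:
  assumes "c \<in> set line_codes"
  shows "external (line_of c) \<longleftrightarrow> cubic_points c = []"
  using assms by (simp add: external_def lines_eq cubic_line_of_empty_iff)

lemma UnG_lines_eq:
  "UnG_lines = line_of ` {c \<in> set line_codes. length (cubic_points c) = 1 \<and> osc_planes c = []}"
  unfolding UnG_lines_def
proof (rule Collect_line_of)
  fix c assume c: "c \<in> set line_codes"
  show "unisecant (line_of c) \<and> \<not> (\<exists>t. line_of c \<subseteq> osc t) \<longleftrightarrow>
      length (cubic_points c) = 1 \<and> osc_planes c = []"
    by (simp add: unisecant_line_of[OF c] line_of_subset_osc_iff[OF c] ex_in_conv)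
qed (simp add: unisecant_def)

lemma EG_lines_eq:
  "EG_lines = line_of ` {c \<in> set line_codes. cubic_points c = [] \<and> length (osc_planes c) = 1}"
  unfolding EG_lines_def
proof (rule Collect_line_of)
  fix c assume c: "c \<in> set line_codes"
  have "distinct (osc_planes c)" by (simp add: osc_planes_def ogfs_def gfs_def)
  then have "length (osc_planes c) = card (set (osc_planes c))" by (simp add: distinct_card)
  then have "(\<exists>!t. t \<in> set (osc_planes c)) \<longleftrightarrow> length (osc_planes c) = 1"
    by (auto simp: card_1_singleton_iff)
  then show "external (line_of c) \<and> (\<exists>!t. line_of c \<subseteq> osc t) \<longleftrightarrow>
      cubic_points c = [] \<and> length (osc_planes c) = 1"
    by (simp add: external_line_of[OF c] line_of_subset_osc_iff[OF c])
qed (simp add: external_def)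

text \<open>The inclusions keep the chord and axis codes within the set on which
  \<open>line_of\<close> is injective, where membership of lines and membership of codes
  agree.\<close>

lemma EnG_lines_iff:
  assumes "c \<in> set line_codes" "set IC_codes \<subseteq> set line_codes" "set IA_codes \<subseteq> set line_codes"
  shows "line_of c \<in> EnG_lines \<longleftrightarrow>
    cubic_points c = [] \<and> osc_planes c = [] \<and> c \<notin> set IC_codes \<and> c \<notin> set IA_codes"
  using assms inj_on_line_of
  by (simp add: EnG_lines_def external_line_of line_of_subset_osc_iff IC_lines_eq IA_lines_eq
      inj_on_image_mem_iff)

lemma UG_lines_iff:
  assumes "c \<in> set line_codes" "set Tr_codes \<subseteq> set line_codes"
  shows "line_of c \<in> UG_lines \<longleftrightarrow> length (cubic_points c) = 1 \<and> osc_planes c \<noteq> [] \<and> c \<notin> set Tr_codes"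
  using assms inj_on_line_of
  by (auto simp: UG_lines_def unisecant_line_of line_of_subset_osc_iff Tr_lines_eq
      inj_on_image_mem_iff ex_in_conv)

section \<open>The orbits\<close>

text \<open>\<open>rRC\<close> joins P(\<open>Ga\<close>) and P(\<open>Gb\<close>);
  \<open>rRA\<close> is the intersection of the osculating planes at 0 and infinity;
  \<open>rT\<close> is the tangent at P(0); \<open>rI\<close> is the imaginary chord with T = N =
  \<open>Ga\<close>; \<open>rA1\<close>, \<open>rA2\<close>, \<open>rA3\<close> are the lines x1 =
  0, x0 = c x3 for c = 1, \<open>Ga\<close>, \<open>Gb\<close>.\<close>

abbreviation rRC where "rRC \<equiv> (Row G0 G1 G1 G0, Row G1 G1 G0 G1)"
abbreviation rRA where "rRA \<equiv> (Row G0 G1 G0 G0, Row G0 G0 G1 G0)"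
abbreviation rUn where "rUn \<equiv> (Row G0 G0 G1 G0, Row G1 G1 G0 G1)"
abbreviation rE where "rE \<equiv> (Row G0 G0 G1 G0, Row G0 G1 G0 G1)"
abbreviation rT where "rT \<equiv> (Row G0 G0 G1 G0, Row G0 G0 G0 G1)"
abbreviation rU5 where "rU5 \<equiv> (Row G0 G1 G0 G0, Row G0 G0 G0 G1)"
abbreviation rU15 where "rU15 \<equiv> (Row G0 G1 G1 G0, Row G0 G0 G0 G1)"
abbreviation rI where "rI \<equiv> (Row G1 Ga G1 G0, Row Gb Ga G0 G1)"
abbreviation rA1 where "rA1 \<equiv> (Row G0 G0 G1 G0, Row G1 G0 G0 G1)"
abbreviation rA2 where "rA2 \<equiv> (Row G0 G0 G1 G0, Row Ga G0 G0 G1)"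
abbreviation rA3 where "rA3 \<equiv> (Row G0 G0 G1 G0, Row Gb G0 G0 G1)"
abbreviation rB1 where "rB1 \<equiv> (Row G0 G1 G1 G0, Row G1 Ga G0 G1)"
abbreviation rB2 where "rB2 \<equiv> (Row G0 G1 G1 G0, Row G1 Gb G0 G1)"
abbreviation rB3 where "rB3 \<equiv> (Row G0 G0 G1 G0, Row Ga G1 G0 G1)"
abbreviation rB4 where "rB4 \<equiv> (Row G0 G0 G1 G0, Row Gb G1 G0 G1)"

definition full_reps :: "(row \<times> row) list" where
  "full_reps = [rRC, rRA, rUn, rE, rU15, rT, rI, rA1, rA2, rB1, rB2, rB3]"

lemma RC_codes_orbit:
  "set (filter (\<lambda>c. 2 \<le> length (cubic_points c)) line_codes) = set (full_orbit rRC)"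
  by code_simp

lemma UnG_codes_orbit:
  "set (filter (\<lambda>c. length (cubic_points c) = 1 \<and> osc_planes c = []) line_codes) = set (full_orbit rUn)"
  by code_simp

text \<open>Counting incident cubic points and osculating planes does not separate tangents from the
  other unisecants in osculating planes, so both are treated together.\<close>

lemma UG_Tr_codes_orbits:
  "set (filter (\<lambda>c. length (cubic_points c) = 1 \<and> osc_planes c \<noteq> []) line_codes) =
    set (full_orbit rT @ full_orbit rU15)"
  by code_simp

text \<open>The description by incidence serves to show that the orbits exhaust all codes, the one
  by pairs of planes to identify the orbit with \<open>RA_lines\<close>.\<close>

lemma RA_codes_orbit:
  "set (filter (\<lambda>c. cubic_points c = [] \<and> 2 \<le> length (osc_planes c)) line_codes) = set (full_orbit rRA)"
  "set RA_codes = set (full_orbit rRA)"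
  by code_simp+

lemma EG_codes_orbit:
  "set (filter (\<lambda>c. cubic_points c = [] \<and> length (osc_planes c) = 1) line_codes) = set (full_orbit rE)"
  by code_simp

lemma EnG_IC_IA_codes_orbits:
  "set (filter (\<lambda>c. cubic_points c = [] \<and> osc_planes c = []) line_codes) =
    set (full_orbit rI @ full_orbit rA1 @ full_orbit rA2 @ full_orbit rB1 @ full_orbit rB2 @ full_orbit rB3)"
  by code_simp

text \<open>The swap preserves the quadric x0 x3 = x1 x2 and exchanges its reguli. One consists of
  the tangents, the other is the orbit of the line x0 = x2 = 0, namely \<open>rU5\<close>.\<close>

lemma Tr_U5_orbit: "set (full_orbit rT) = set (Tr_codes @ star_orbit rU5)"
  by code_simp

text \<open>The swap fixes the line \<open>rU15\<close> and normalises \<open>Gq_star\<close>, so it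
  adds nothing to the orbit.\<close>

lemma U15_orbit: "set (full_orbit rU15) = set (star_orbit rU15)"
  by code_simp

text \<open>The swap turns the chord of X^2 + T X + N into the axis with trace 1/T and norm T + N/T.
  The verification uses u^2 + u + 1 = 0 for u = N/T^2, which is irreducibility of the quadratic over
  F_4.\<close>

lemma IC_IA_orbit: "set (full_orbit rI) = set (IC_codes @ IA_codes)"
  by code_simp

text \<open>The swap carries x1 = 0, x0 = c x3 to x2 = 0, x0 = c x3. The map t \<mapsto> 1/t
  reverses the coordinates and carries this to x1 = 0, x0 = x3 / c. So c is paired with 1/c, and c =
  1 with itself.\<close>

lemma A1_orbit: "set (full_orbit rA1) = set (star_orbit rA1)"
  by code_simp

text \<open>\<open>Ga\<close> and \<open>Gb\<close> are inverse to each other, so their lines are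
  exchanged.\<close>

lemma A23_orbit: "set (full_orbit rA2) = set (star_orbit rA2 @ star_orbit rA3)"
  by code_simp

text \<open>The swap fixes the line \<open>rB1\<close>: it preserves the first row and changes the
  second by \<open>Ga\<close> times the first. The same holds for \<open>rB2\<close> with
  \<open>Gb\<close>.\<close>

lemma B1_orbit: "set (full_orbit rB1) = set (star_orbit rB1)"
  by code_simp

lemma B2_orbit: "set (full_orbit rB2) = set (star_orbit rB2)"
  by code_simp

lemma B34_orbit: "set (full_orbit rB3) = set (star_orbit rB3 @ star_orbit rB4)"
  by code_simp

lemma star_orbit_lengths:
  "map (length \<circ> star_orbit) [rU5, rU15, rA1, rA2, rA3, rB1, rB2, rB3, rB4] =
    [5, 15, 20, 20, 20, 30, 30, 30, 30]"
  by code_simp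

text \<open>Together with the unmerged orbits of sizes 15, 20, 30 and 30 these numbers add up to
  357, the number of lines.\<close>

lemma full_orbit_cards:
  "map (length \<circ> remdups \<circ> full_orbit) [rRC, rRA, rUn, rE, rT, rI, rA2, rB3] =
    [10, 10, 60, 60, 10, 12, 40, 60]"
  by code_simp

lemma U5_U15_disjoint_Tr: "\<forall>c\<in>set (star_orbit rU5 @ star_orbit rU15). c \<notin> set Tr_codes"
  by code_simp

lemma orbits_disjoint_IC_IA:
  "\<forall>c\<in>set (star_orbit rA1 @ star_orbit rA2 @ star_orbit rA3 @ star_orbit rB1 @ star_orbit rB2 @
      star_orbit rB3 @ star_orbit rB4). c \<notin> set IC_codes \<and> c \<notin> set IA_codes"
  by code_simp

text \<open>A representative lies in its own orbit, so its absence from another orbit already makes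
  the two differ; one direction for each pair is enough.\<close>

lemma star_orbits_separated:
  "rA1 \<notin> set (star_orbit rA2)" "rA1 \<notin> set (star_orbit rA3)" "rA2 \<notin> set (star_orbit rA3)"
  "rB1 \<notin> set (star_orbit rB2)" "rB1 \<notin> set (star_orbit rB3)" "rB1 \<notin> set (star_orbit rB4)"
  "rB2 \<notin> set (star_orbit rB3)" "rB2 \<notin> set (star_orbit rB4)" "rB3 \<notin> set (star_orbit rB4)"
  by code_simp+

lemma own_orbits:
  "rA1 \<in> set (star_orbit rA1)" "rA2 \<in> set (star_orbit rA2)" "rB1 \<in> set (star_orbit rB1)"
  "rB2 \<in> set (star_orbit rB2)" "rB3 \<in> set (star_orbit rB3)"
  by code_simp+

lemma full_orbits_separated:
  "\<forall>r\<in>set full_reps. \<forall>r'\<in>set full_reps. r' \<in> set (full_orbit r) \<longrightarrow> r = r'"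
  by code_simp

lemma full_reps_length: "length (remdups full_reps) = 12"
  by code_simp

text \<open>Reversal of the coordinates takes x1 = 0, x0 = c x3 to x2 = 0, x0 = x3 / c. For equal
  \<xi> the lines \<open>ell1\<close> and \<open>ell2\<close> therefore correspond to inverse values
  of c and fall into different orbits.\<close>

lemma ell_orbits:
  "(Row 0 1 0 0, Row Ga 0 0 1) \<in> set (star_orbit rA3)" "(Row 0 1 0 0, Row Gb 0 0 1) \<in> set (star_orbit rA2)"
  "(Row 0 0 1 0, Row Ga 0 0 1) \<in> set (star_orbit rA2)" "(Row 0 0 1 0, Row Gb 0 0 1) \<in> set (star_orbit rA3)"
  by code_simp+

lemma reps_in_line_codes:
  "set (rU5 # rA3 # rB4 # full_reps) \<subseteq> set line_codes"
  by code_simp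

lemma idm_in_Gq: "idm \<in> Gq"
  by (auto simp: Gq_def invertible_mat_def mmul_idm pmap_idm)

lemma line_orbits_Gq: "line_orbits Gq = (\<lambda>r. line_of ` set (full_orbit r)) ` set full_reps"
proof -
  have reps: "r \<in> set line_codes" if "r \<in> set full_reps" for r
    using that reps_in_line_codes by auto
  have "\<exists>r\<in>set full_reps. c \<in> set (full_orbit r)" if c: "c \<in> set line_codes" for c
  proof -
    \<comment> \<open>The possible incidence counts; each case is the filter of one of the orbit
      computations.\<close>
    consider "2 \<le> length (cubic_points c)" | "length (cubic_points c) = 1" "osc_planes c = []"
      | "length (cubic_points c) = 1" "osc_planes c \<noteq> []" | "cubic_points c = []" "osc_planes c = []"
      | "cubic_points c = []" "length (osc_planes c) = 1" | "cubic_points c = []" "2 \<le> length (osc_planes c)"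
      by (metis One_nat_def Suc_1 length_0_conv less_2_cases not_less)
    then have "c \<in> set (full_orbit rRC) \<or> c \<in> set (full_orbit rUn) \<or> c \<in> set (full_orbit rT @ full_orbit rU15) \<or>
       c \<in> set (full_orbit rI @ full_orbit rA1 @ full_orbit rA2 @ full_orbit rB1 @ full_orbit rB2 @ full_orbit rB3) \<or>
       c \<in> set (full_orbit rE) \<or> c \<in> set (full_orbit rRA)"
      unfolding RC_codes_orbit[symmetric] UnG_codes_orbit[symmetric] UG_Tr_codes_orbits[symmetric]
        EnG_IC_IA_codes_orbits[symmetric] EG_codes_orbit[symmetric] RA_codes_orbit(1)[symmetric]
      using c by cases simp_all
    then show ?thesis by (auto simp: full_reps_def)
  qed
  note cover = this
  have "line_orbits Gq = (\<lambda>c. line_orbit Gq (line_of c)) ` set line_codes"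
    by (simp add: line_orbits_def lines_eq image_image)
  also have "\<dots> = (\<lambda>r. line_orbit Gq (line_of r)) ` set full_reps"
  proof
    show "(\<lambda>c. line_orbit Gq (line_of c)) ` set line_codes \<subseteq> (\<lambda>r. line_orbit Gq (line_of r)) ` set full_reps"
    proof (rule image_subsetI)
      fix c assume "c \<in> set line_codes"
      then obtain r where r: "r \<in> set full_reps" "c \<in> set (full_orbit r)" using cover by blast
      then have "line_of c \<in> line_orbit Gq (line_of r)"
        unfolding line_orbit_Gq[OF reps[OF r(1)]] by blast
      then have "line_orbit Gq (line_of c) = line_orbit Gq (line_of r)" by (rule line_orbit_Gq_eq)
      with r(1) show "line_orbit Gq (line_of c) \<in> (\<lambda>r. line_orbit Gq (line_of r)) ` set full_reps" by blast
    qed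
    show "(\<lambda>r. line_orbit Gq (line_of r)) ` set full_reps \<subseteq> (\<lambda>c. line_orbit Gq (line_of c)) ` set line_codes"
      using reps by blast
  qed
  also have "\<dots> = (\<lambda>r. line_of ` set (full_orbit r)) ` set full_reps"
    using line_orbit_Gq reps by (intro image_cong) auto
  finally show ?thesis .
qed

lemma card_line_orbits_Gq: "card (line_orbits (Gq :: gf4 mat set)) = 12"
proof -
  have "inj_on (\<lambda>r. line_of ` set (full_orbit r)) (set full_reps)"
  proof (rule inj_onI)
    fix r r' assume r: "r \<in> set full_reps" "r' \<in> set full_reps"
      and e: "line_of ` set (full_orbit r) = line_of ` set (full_orbit r')"
    have c: "r \<in> set line_codes" "r' \<in> set line_codes" using r reps_in_line_codes by auto
    have "line_of r' \<in> line_orbit Gq (line_of r')"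
      unfolding line_orbit_def using idm_in_Gq lmap_idm[of "line_of r'"] by (metis image_eqI)
    then have "line_of r' \<in> line_of ` set (full_orbit r)"
      by (simp add: line_orbit_Gq[OF c(2)] e)
    then have "r' \<in> set (full_orbit r)"
      using inj_on_image_mem_iff[OF inj_on_line_of c(2) full_orbit_subset] by blast
    with r show "r = r'" using full_orbits_separated by blast
  qed
  then have "card (line_orbits (Gq :: gf4 mat set)) = card (set full_reps)"
    unfolding line_orbits_Gq by (rule card_image)
  then show ?thesis using full_reps_length by (simp add: length_remdups_card_conv)
qed

lemma card_line_of: "set cs \<subseteq> set line_codes \<Longrightarrow> card (line_of ` set cs) = length (remdups cs)"
  using inj_on_line_of by (simp add: card_image inj_on_subset length_remdups_card_conv)

lemma card_star_orbit: "card (line_of ` set (star_orbit r)) = length (star_orbit r)"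
  using card_line_of[OF star_orbit_subset, of r] by (simp add: star_orbit_def)

lemma star_orbit_neq:
  assumes "r \<in> set line_codes" "r \<in> set (star_orbit r)" "r \<notin> set (star_orbit r')"
  shows "line_of ` set (star_orbit r) \<noteq> line_of ` set (star_orbit r')"
  using assms inj_on_image_mem_iff[OF inj_on_line_of assms(1) star_orbit_subset, of r'] by blast

theorem theorem6p3:
  shows "\<exists>O5 O15 A1 A2 A3 B1 B2 B3 B4.
    O5 \<in> line_orbits (Gq_star::gf4 mat set) \<and> O15 \<in> line_orbits (Gq_star::gf4 mat set) \<and>
    O5 \<subseteq> UG_lines \<and> O15 \<subseteq> UG_lines \<and> card O5 = 5 \<and> card O15 = 15 \<and>
    {A1, A2, A3, B1, B2, B3, B4} \<subseteq> line_orbits (Gq_star::gf4 mat set) \<and>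
    A1 \<subseteq> EnG_lines \<and> A2 \<subseteq> EnG_lines \<and> A3 \<subseteq> EnG_lines \<and>
    B1 \<subseteq> EnG_lines \<and> B2 \<subseteq> EnG_lines \<and> B3 \<subseteq> EnG_lines \<and> B4 \<subseteq> EnG_lines \<and>
    card A1 = 20 \<and> card A2 = 20 \<and> card A3 = 20 \<and>
    card B1 = 30 \<and> card B2 = 30 \<and> card B3 = 30 \<and> card B4 = 30 \<and>
    distinct [A1, A2, A3] \<and> distinct [B1, B2, B3, B4] \<and>
    line_orbits (Gq::gf4 mat set) =
      {RC_lines, RA_lines, UnG_lines, EG_lines, O15, Tr_lines \<union> O5, IC_lines \<union> IA_lines,
       A1, A2 \<union> A3, B1, B2, B3 \<union> B4} \<and>
    card (line_orbits (Gq::gf4 mat set)) = 12 \<and>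
    card RC_lines = 10 \<and> card RA_lines = 10 \<and> card UnG_lines = 60 \<and> card EG_lines = 60 \<and>
    card (Tr_lines \<union> O5) = 10 \<and> card (IC_lines \<union> IA_lines) = 12 \<and>
    card (A2 \<union> A3) = 40 \<and> card (B3 \<union> B4) = 60 \<and>
    (\<forall>\<xi>. primitive_elem \<xi> \<longrightarrow>
       ell1 \<xi> \<in> EnG_lines \<and> ell2 \<xi> \<in> EnG_lines \<and>
       ((ell1 \<xi> \<in> A2 \<and> ell2 \<xi> \<in> A3) \<or> (ell1 \<xi> \<in> A3 \<and> ell2 \<xi> \<in> A2)))"
proof -
  define S where "S r = line_of ` set (star_orbit r)" for r
  define F where "F r = line_of ` set (full_orbit r)" for r
  \<comment> \<open>These lists make up parts of orbits, and orbits consist of codes.\<close>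
  have codes: "set IC_codes \<subseteq> set line_codes" "set IA_codes \<subseteq> set line_codes" "set Tr_codes \<subseteq> set line_codes"
    using IC_IA_orbit Tr_U5_orbit full_orbit_subset by (metis Un_subset_iff set_append)+
  have star: "S r \<in> line_orbits Gq_star" if "r \<in> set line_codes" for r
    using that line_orbit_Gq_star[OF that] unfolding S_def line_orbits_def lines_eq by blast
  have reps: "r \<in> set line_codes" if "r \<in> set [rU5, rU15, rA1, rA2, rA3, rB1, rB2, rB3, rB4]" for r
    using that reps_in_line_codes by (auto simp: full_reps_def)
  have F_unions: "F rRC = RC_lines" "F rRA = RA_lines" "F rUn = UnG_lines" "F rE = EG_lines" "F rU15 = S rU15"
    "F rT = Tr_lines \<union> S rU5" "F rI = IC_lines \<union> IA_lines" "F rA1 = S rA1" "F rA2 = S rA2 \<union> S rA3"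
    "F rB1 = S rB1" "F rB2 = S rB2" "F rB3 = S rB3 \<union> S rB4"
    unfolding F_def S_def
    by (simp_all only: RC_codes_orbit[symmetric] RA_codes_orbit(2)[symmetric] UnG_codes_orbit[symmetric]
        EG_codes_orbit[symmetric] U15_orbit Tr_U5_orbit IC_IA_orbit A1_orbit A23_orbit B1_orbit B2_orbit
        B34_orbit set_append image_Un RC_lines_eq RA_lines_eq UnG_lines_eq EG_lines_eq Tr_lines_eq
        IC_lines_eq IA_lines_eq set_filter)
  have orbits: "line_orbits Gq = F ` set full_reps"
    unfolding line_orbits_Gq F_def ..
  have card_F: "card (F r) = length (remdups (full_orbit r))" for r
    unfolding F_def by (rule card_line_of[OF full_orbit_subset])
  have card_S: "card (S r) = length (star_orbit r)" for r
    unfolding S_def by (rule card_star_orbit)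
  have UG: "S r \<subseteq> UG_lines" if "r = rU5 \<or> r = rU15" for r
  proof -
    have "line_of c \<in> UG_lines" if c: "c \<in> set (star_orbit r)" for c
    proof -
      have "c \<in> set (full_orbit rT @ full_orbit rU15)"
        using c \<open>r = rU5 \<or> r = rU15\<close> by (auto simp only: set_append Tr_U5_orbit U15_orbit)
      then have "length (cubic_points c) = 1 \<and> osc_planes c \<noteq> []"
        unfolding UG_Tr_codes_orbits[symmetric] by simp
      moreover have "c \<notin> set Tr_codes"
        using c \<open>r = rU5 \<or> r = rU15\<close> U5_U15_disjoint_Tr by auto
      ultimately show ?thesis
        using UG_lines_iff[OF subsetD[OF star_orbit_subset c] codes(3)] by blast
    qed
    then show ?thesis unfolding S_def by blast
  qed
  have EnG: "S r \<subseteq> EnG_lines" if r: "r \<in> {rA1, rA2, rA3, rB1, rB2, rB3, rB4}" for r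
  proof -
    have "line_of c \<in> EnG_lines" if c: "c \<in> set (star_orbit r)" for c
    proof -
      have "c \<in> set (full_orbit rI @ full_orbit rA1 @ full_orbit rA2 @ full_orbit rB1 @ full_orbit rB2 @ full_orbit rB3)"
        using c r by (auto simp only: set_append A1_orbit A23_orbit B1_orbit B2_orbit B34_orbit)
      then have "cubic_points c = [] \<and> osc_planes c = []"
        unfolding EnG_IC_IA_codes_orbits[symmetric] by simp
      moreover have "c \<notin> set IC_codes \<and> c \<notin> set IA_codes"
        using c r orbits_disjoint_IC_IA by auto
      ultimately show ?thesis
        using EnG_lines_iff[OF subsetD[OF star_orbit_subset c] codes(1,2)] by blast
    qed
    then show ?thesis unfolding S_def by blast
  qed
  have ell: "(ell1 \<xi> \<in> S rA2 \<and> ell2 \<xi> \<in> S rA3) \<or> (ell1 \<xi> \<in> S rA3 \<and> ell2 \<xi> \<in> S rA2)"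
    if "primitive_elem \<xi>" for \<xi>
    using primitive_elem_cases[OF that] ell_orbits unfolding S_def ell1_eq ell2_eq by blast
  have neq: "S r \<noteq> S r'"
    if "r \<in> set [rU5, rU15, rA1, rA2, rA3, rB1, rB2, rB3, rB4]" "r \<in> set (star_orbit r)" "r \<notin> set (star_orbit r')" for r r'
    unfolding S_def using that by (intro star_orbit_neq reps)
  show ?thesis
  proof (rule exI[of _ "S rU5"], rule exI[of _ "S rU15"], rule exI[of _ "S rA1"], rule exI[of _ "S rA2"],
      rule exI[of _ "S rA3"], rule exI[of _ "S rB1"], rule exI[of _ "S rB2"], rule exI[of _ "S rB3"],
      rule exI[of _ "S rB4"], intro conjI allI impI)
    show "distinct [S rA1, S rA2, S rA3]" "distinct [S rB1, S rB2, S rB3, S rB4]"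
      using neq star_orbits_separated own_orbits by simp_all
    show "line_orbits (Gq::gf4 mat set) =
      {RC_lines, RA_lines, UnG_lines, EG_lines, S rU15, Tr_lines \<union> S rU5, IC_lines \<union> IA_lines,
       S rA1, S rA2 \<union> S rA3, S rB1, S rB2, S rB3 \<union> S rB4}"
      unfolding orbits full_reps_def list.set image_insert image_empty F_unions ..
    show "card (line_orbits (Gq::gf4 mat set)) = 12" by (rule card_line_orbits_Gq)
    show "card RC_lines = 10" "card RA_lines = 10" "card UnG_lines = 60" "card EG_lines = 60"
      "card (Tr_lines \<union> S rU5) = 10" "card (IC_lines \<union> IA_lines) = 12"
      "card (S rA2 \<union> S rA3) = 40" "card (S rB3 \<union> S rB4) = 60"
      unfolding F_unions[symmetric] card_F using full_orbit_cards by simp_all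
    fix \<xi> assume "primitive_elem \<xi>"
    then show "(ell1 \<xi> \<in> S rA2 \<and> ell2 \<xi> \<in> S rA3) \<or> (ell1 \<xi> \<in> S rA3 \<and> ell2 \<xi> \<in> S rA2)"
      "ell1 \<xi> \<in> EnG_lines" "ell2 \<xi> \<in> EnG_lines"
      using ell EnG by blast+
  qed (use star_orbit_lengths in \<open>simp_all add: star reps UG EnG card_S\<close>)
qed

end
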